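(* Let $q$ be a prime power, $m\ge1$ and $1\le k\le q-1$. Then $$\dim\mathrm{PLift}_q(m,k)=\Big(\sum_{j=1}^m\dim\mathrm{Lift}_q(j,k-1)\Big)+1,$$ where dimensions are over $\mathbb F_q$.
   Context: Projective side. $\mathbb P^m=(\mathbb F_q^{m+1}\setminus\{0\})/\mathbb F_q^\times$; the standard representative of a point is the one whose leftmost non-zero coordinate is $1$. $\mathbb F_q[\mathbf X]^H_v$ is the space of homogeneous polynomials of degree $v$ in $X_0,\dots,X_m$ (together with $0$), and $\mathrm{ev}_{\mathbb P^m}(f)=(f(\mathbf P))_{\mathbf P\in\mathbb P^m}$, evaluating at standard representatives. $\mathrm{PRS}_q(k)=\{\mathrm{ev}_{\mathbb P^1}(g): g\in\mathbb F_q[S,T]^H_k\}$. $\mathrm{Emb}_{\mathbb P}(m)$ is the set of injective $\mathbb F_q$-linear maps $L:\mathbb F_q^2\to\mathbb F_q^{m+1}$, and $f\circ L=f(L(S,T))$. For $m\ge1$, $1\le k\le q-1$ and $v=k+(m-1)(q-1)$, $$\mathrm{PLift}_q(m,k)=\{\mathrm{ev}_{\mathbb P^m}(f): f\in\mathbb F_q[\mathbf X]^H_v,\ \forall L\in\mathrm{Emb}_{\mathbb P}(m),\ \mathrm{ev}_{\mathbb P^1}(f\circ L)\in\mathrm{PRS}_q(k)\}.$$ Affine side. For $f\in\mathbb F_q[X_1,\dots,X_m]$, $\mathrm{ev}_{\mathbb A^m}(f)=(f(\mathbf x))_{\mathbf x\in\mathbb F_q^m}$. $\mathrm{RS}_q(k)=\{\mathrm{ev}_{\mathbb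 A^1}(g): g\in\mathbb F_q[T],\deg g\le k\}$. $\mathrm{Emb}_{\mathbb A}(m)$ is the set of linear maps $L^*=(L_1,\dots,L_m):\mathbb F_q^2\to\mathbb F_q^m$ for which some $L_0$ makes $(L_0,\dots,L_m)$ an element of $\mathrm{Emb}_{\mathbb P}(m)$; $f\circ L^*$ is the univariate polynomial $f(L^*(1,T))$. For $m\ge1$, $0\le k\le q-2$, $$\mathrm{Lift}_q(m,k)=\{\mathrm{ev}_{\mathbb A^m}(f): f\in\mathbb F_q[X_1,\dots,X_m],\ \forall L\in\mathrm{Emb}_{\mathbb A}(m),\ \mathrm{ev}_{\mathbb A^1}(f\circ L)\in\mathrm{RS}_q(k)\}.$$ *)

theory Defs
  imports
    "HOL-Library.Poly_Mapping"
    "HOL-Library.Cardinality"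
    "HOL-Library.Function_Algebras"
    "HOL-Computational_Algebra.Polynomial"
begin

section \<open>Spaces of functions into a field\<close>

definition fun_scale :: "'a::field \<Rightarrow> ('i \<Rightarrow> 'a) \<Rightarrow> 'i \<Rightarrow> 'a" where
  "fun_scale c w = (\<lambda>i. c * w i)"

text \<open>This provides \<open>word.dim\<close>, the dimension over the field, both for spaces of
  vectors and for codes (spaces of functions on a set of evaluation points).\<close>

global_interpretation word: vector_space "fun_scale :: 'a::field \<Rightarrow> ('i \<Rightarrow> 'a) \<Rightarrow> 'i \<Rightarrow> 'a"
  by unfold_locales (simp_all add: fun_scale_def fun_eq_iff algebra_simps)

text \<open>Vectors with coordinates indexed by \<open>I\<close>; coordinates outside \<open>I\<close> are fixed to be 0.
  Thus \<open>vecs {0..m}\<close> is the \<open>(m + 1)\<close>-dimensional space with coordinates \<open>0, \<dots>, m\<close> and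
  \<open>vecs {1..m}\<close> the \<open>m\<close>-dimensional space with coordinates \<open>1, \<dots>, m\<close>.\<close>

definition vecs :: "nat set \<Rightarrow> (nat \<Rightarrow> 'a::field) set" where
  "vecs I = {x. \<forall>i. i \<notin> I \<longrightarrow> x i = 0}"

definition unit_vec :: "nat \<Rightarrow> nat \<Rightarrow> 'a::field" where
  "unit_vec j = (\<lambda>i. if i = j then 1 else 0)"

text \<open>Only the values of \<open>L\<close> on \<open>vecs I\<close> are relevant.\<close>

definition linear_between ::
  "nat set \<Rightarrow> nat set \<Rightarrow> ((nat \<Rightarrow> 'a::field) \<Rightarrow> (nat \<Rightarrow> 'a)) \<Rightarrow> bool" where
  "linear_between I J L \<longleftrightarrow>
     (\<forall>x\<in>vecs I. L x \<in> vecs J) \<and>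
     (\<forall>x\<in>vecs I. \<forall>y\<in>vecs I. L (x + y) = L x + L y) \<and>
     (\<forall>c. \<forall>x\<in>vecs I. L (fun_scale c x) = fun_scale c (L x))"


section \<open>Multivariate polynomials\<close>

text \<open>A monomial is a finitely supported exponent function, a polynomial a finitely supported
  family of coefficients; multiplication is the convolution product.\<close>

type_synonym 'a mvpoly = "(nat \<Rightarrow>\<^sub>0 nat) \<Rightarrow>\<^sub>0 'a"

definition mv_const :: "'a::field \<Rightarrow> 'a mvpoly" where
  "mv_const c = Poly_Mapping.single 0 c"

definition mv_var :: "nat \<Rightarrow> 'a::field mvpoly" where
  "mv_var i = Poly_Mapping.single (Poly_Mapping.single i 1) 1"

definition mv_polys :: "nat set \<Rightarrow> 'a::field mvpoly set" where
  "mv_polys I = {f. \<forall>e\<in>Poly_Mapping.keys f. Poly_Mapping.keys e \<subseteq> I}"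

definition mono_degree :: "(nat \<Rightarrow>\<^sub>0 nat) \<Rightarrow> nat" where
  "mono_degree e = (\<Sum>i\<in>Poly_Mapping.keys e. Poly_Mapping.lookup e i)"

definition hom_polys :: "nat set \<Rightarrow> nat \<Rightarrow> 'a::field mvpoly set" where
  "hom_polys I v = {f \<in> mv_polys I. \<forall>e\<in>Poly_Mapping.keys f. mono_degree e = v}"

text \<open>Substitution of \<open>g i\<close> for the \<open>i\<close>-th variable, where \<open>h\<close> embeds the coefficients in the
  target ring.\<close>

definition mv_subst :: "('a::field \<Rightarrow> 'b::comm_ring_1) \<Rightarrow> (nat \<Rightarrow> 'b) \<Rightarrow> 'a mvpoly \<Rightarrow> 'b" where
  "mv_subst h g f =
     (\<Sum>e\<in>Poly_Mapping.keys f. h (Poly_Mapping.lookup f e) *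
        (\<Prod>i\<in>Poly_Mapping.keys e. g i ^ Poly_Mapping.lookup e i))"

definition mv_eval :: "'a::field mvpoly \<Rightarrow> (nat \<Rightarrow> 'a) \<Rightarrow> 'a" where
  "mv_eval f x = mv_subst (\<lambda>c. c) x f"


section \<open>Projective space and projective lifted codes\<close>

definition nonzero_vecs :: "nat \<Rightarrow> (nat \<Rightarrow> 'a::field) set" where
  "nonzero_vecs m = vecs {0..m} - {0}"

definition proportional :: "nat \<Rightarrow> ((nat \<Rightarrow> 'a::field) \<times> (nat \<Rightarrow> 'a)) set" where
  "proportional m = {(x, y). x \<in> nonzero_vecs m \<and> y \<in> nonzero_vecs m \<and>
     (\<exists>c. c \<noteq> 0 \<and> y = fun_scale c x)}"

definition proj_space :: "nat \<Rightarrow> (nat \<Rightarrow> 'a::field) set set" where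
  "proj_space m = nonzero_vecs m // proportional m"

definition std_rep :: "(nat \<Rightarrow> 'a::field) set \<Rightarrow> nat \<Rightarrow> 'a" where
  "std_rep P = (THE x. x \<in> P \<and> x (LEAST i. x i \<noteq> 0) = 1)"

text \<open>Codewords are functions on the evaluation points, extended by 0.\<close>

definition ev_proj :: "nat \<Rightarrow> 'a::field mvpoly \<Rightarrow> (nat \<Rightarrow> 'a) set \<Rightarrow> 'a" where
  "ev_proj m f = (\<lambda>P. if P \<in> proj_space m then mv_eval f (std_rep P) else 0)"

text \<open>The variables \<open>S, T\<close> are the variables 0 and 1.\<close>

definition PRS :: "nat \<Rightarrow> ((nat \<Rightarrow> 'a::field) set \<Rightarrow> 'a) set" where
  "PRS k = ev_proj 1 ` hom_polys {0, 1} k"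

definition Emb_proj :: "nat \<Rightarrow> ((nat \<Rightarrow> 'a::field) \<Rightarrow> (nat \<Rightarrow> 'a)) set" where
  "Emb_proj m = {L. linear_between {0, 1} {0..m} L \<and> inj_on L (vecs {0, 1})}"

text \<open>The \<open>i\<close>-th component of \<open>L (S, T)\<close> is the linear form \<open>L (1, 0) i * S + L (0, 1) i * T\<close>.\<close>

definition comp_proj :: "'a::field mvpoly \<Rightarrow> ((nat \<Rightarrow> 'a) \<Rightarrow> (nat \<Rightarrow> 'a)) \<Rightarrow> 'a mvpoly" where
  "comp_proj f L = mv_subst mv_const
     (\<lambda>i. mv_const (L (unit_vec 0) i) * mv_var 0 + mv_const (L (unit_vec 1) i) * mv_var 1) f"

definition PLift :: "nat \<Rightarrow> nat \<Rightarrow> ((nat \<Rightarrow> 'a::{field,finite}) set \<Rightarrow> 'a) set" where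
  "PLift m k = {ev_proj m f | f. f \<in> hom_polys {0..m} (k + (m - 1) * (CARD('a) - 1)) \<and>
     (\<forall>L\<in>Emb_proj m. ev_proj 1 (comp_proj f L) \<in> PRS k)}"


section \<open>Affine lifted codes\<close>

definition ev_aff :: "nat \<Rightarrow> 'a::field mvpoly \<Rightarrow> (nat \<Rightarrow> 'a) \<Rightarrow> 'a" where
  "ev_aff m f = (\<lambda>x. if x \<in> vecs {1..m} then mv_eval f x else 0)"

text \<open>For \<open>m = 1\<close> the univariate \<open>'a poly\<close> is used, with the field itself as affine line;
  \<open>poly g\<close> is the evaluation word of \<open>g\<close>.\<close>

definition RS :: "nat \<Rightarrow> ('a::field \<Rightarrow> 'a) set" where
  "RS k = poly ` {g. degree g \<le> k}"

definition Emb_aff :: "nat \<Rightarrow> ((nat \<Rightarrow> 'a::field) \<Rightarrow> (nat \<Rightarrow> 'a)) set" where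
  "Emb_aff m = {L. linear_between {0, 1} {1..m} L \<and>
     (\<exists>L0. (\<lambda>x. (L x)(0 := L0 x)) \<in> Emb_proj m)}"

text \<open>The \<open>i\<close>-th component of \<open>L (1, T)\<close> is \<open>L (1, 0) i + L (0, 1) i * T\<close>.\<close>

definition comp_aff :: "'a::field mvpoly \<Rightarrow> ((nat \<Rightarrow> 'a) \<Rightarrow> (nat \<Rightarrow> 'a)) \<Rightarrow> 'a poly" where
  "comp_aff f L = mv_subst (\<lambda>c. [:c:]) (\<lambda>i. [:L (unit_vec 0) i, L (unit_vec 1) i:]) f"

definition Lift :: "nat \<Rightarrow> nat \<Rightarrow> ((nat \<Rightarrow> 'a::{field,finite}) \<Rightarrow> 'a) set" where
  "Lift m k = {ev_aff m f | f. f \<in> mv_polys {1..m} \<and>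
     (\<forall>L\<in>Emb_aff m. poly (comp_aff f L) \<in> RS k)}"

end

theory Submission
  imports Defs "HOL-Library.FuncSet"
begin

text \<open>A projective codeword extends to a function \<open>F\<close> on \<open>F\<^sub>q\<^sup>m\<^sup>+\<^sup>1\<close> that is a binary form of
  degree \<open>k\<close> on every plane through the origin. Restricting \<open>F\<close> to the hyperplane \<open>x\<^sub>0 = 0\<close> gives
  a function of the same kind in one variable less, and every such function arises, from the cone
  over it with vertex \<open>(1, 0, \<dots>, 0)\<close>. If \<open>F\<close> vanishes on the hyperplane, then on every plane the
  binary form is divisible by the equation of the point at infinity, so that the affine part of
  \<open>F\<close> is a word of the affine code with \<open>k - 1\<close>; conversely such words can be homogenized. Over a
  finite field the resulting dimension count is a count of elements, \<open>card V = q ^ dim V\<close>.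

  That \<open>F\<close> is given by a form of degree \<open>k + (m - 1)(q - 1)\<close> is automatic: a cone keeps its values
  when an exponent is raised by \<open>q - 1\<close>, and the words of the affine code have small degree in one
  variable.\<close>

section \<open>Evaluation of multivariate polynomials\<close>

definition mono_eval :: "(nat \<Rightarrow> 'a::field) \<Rightarrow> (nat \<Rightarrow>\<^sub>0 nat) \<Rightarrow> 'a" where
  "mono_eval x e = (\<Prod>i\<in>Poly_Mapping.keys e. x i ^ Poly_Mapping.lookup e i)"

lemma mono_eval_superset:
  assumes "finite A" "Poly_Mapping.keys e \<subseteq> A"
  shows "mono_eval x e = (\<Prod>i\<in>A. x i ^ Poly_Mapping.lookup e i)"
  unfolding mono_eval_def
  by (rule prod.mono_neutral_left) (use assms in \<open>auto simp: in_keys_iff\<close>)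

lemma mono_eval_add: "mono_eval x (d + e) = mono_eval x d * mono_eval x e"
proof -
  let ?A = "Poly_Mapping.keys d \<union> Poly_Mapping.keys e"
  have "mono_eval x (d + e) = (\<Prod>i\<in>?A. x i ^ Poly_Mapping.lookup (d + e) i)"
    by (rule mono_eval_superset) (simp_all add: keys_add)
  also have "\<dots> = (\<Prod>i\<in>?A. x i ^ Poly_Mapping.lookup d i) * (\<Prod>i\<in>?A. x i ^ Poly_Mapping.lookup e i)"
    by (simp add: lookup_add power_add prod.distrib)
  also have "\<dots> = mono_eval x d * mono_eval x e"
    by (simp add: mono_eval_superset[of ?A])
  finally show ?thesis .
qed

lemma mono_degree_superset:
  assumes "finite A" "Poly_Mapping.keys e \<subseteq> A"
  shows "mono_degree e = (\<Sum>i\<in>A. Poly_Mapping.lookup e i)"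
  unfolding mono_degree_def
  by (rule sum.mono_neutral_left) (use assms in \<open>auto simp: in_keys_iff\<close>)

lemma mono_degree_add: "mono_degree (d + e) = mono_degree d + mono_degree e"
proof -
  let ?A = "Poly_Mapping.keys d \<union> Poly_Mapping.keys e"
  have "mono_degree (d + e) = (\<Sum>i\<in>?A. Poly_Mapping.lookup (d + e) i)"
    by (rule mono_degree_superset) (simp_all add: keys_add)
  also have "\<dots> = (\<Sum>i\<in>?A. Poly_Mapping.lookup d i) + (\<Sum>i\<in>?A. Poly_Mapping.lookup e i)"
    by (simp add: lookup_add sum.distrib)
  also have "\<dots> = mono_degree d + mono_degree e"
    by (simp add: mono_degree_superset[of ?A])
  finally show ?thesis .
qed

lemma mv_eval_altdef:
  "mv_eval f x = (\<Sum>e\<in>Poly_Mapping.keys f. Poly_Mapping.lookup f e * mono_eval x e)"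
  by (simp add: mv_eval_def mv_subst_def mono_eval_def)

lemma mv_eval_superset:
  assumes "finite A" "Poly_Mapping.keys f \<subseteq> A"
  shows "mv_eval f x = (\<Sum>e\<in>A. Poly_Mapping.lookup f e * mono_eval x e)"
  unfolding mv_eval_altdef
  by (rule sum.mono_neutral_left) (use assms in \<open>auto simp: in_keys_iff\<close>)

lemma mv_eval_add [simp]: "mv_eval (f + g) x = mv_eval f x + mv_eval g x"
proof -
  let ?A = "Poly_Mapping.keys f \<union> Poly_Mapping.keys g"
  have "mv_eval (f + g) x = (\<Sum>e\<in>?A. Poly_Mapping.lookup (f + g) e * mono_eval x e)"
    by (rule mv_eval_superset) (simp_all add: keys_add)
  also have "\<dots> = mv_eval f x + mv_eval g x"
    by (simp add: mv_eval_superset[of ?A] lookup_add sum.distrib algebra_simps)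
  finally show ?thesis .
qed

lemma mv_eval_zero [simp]: "mv_eval 0 x = 0"
  by (simp add: mv_eval_altdef)

lemma mv_eval_single [simp]: "mv_eval (Poly_Mapping.single e c) x = c * mono_eval x e"
  by (simp add: mv_eval_altdef)

text \<open>The rule \<open>update_induct\<close> builds a polynomial by inserting monomials that do
  not occur yet; written as a sum, such a step is within reach of the additivity of
  \<open>mv_eval\<close>.\<close>

lemma update_eq_add_single:
  "k \<notin> Poly_Mapping.keys f \<Longrightarrow> Poly_Mapping.update k v f = f + Poly_Mapping.single k v"
  by (rule poly_mapping_eqI) (auto simp: lookup_update lookup_add lookup_single in_keys_iff when_def)

lemma mv_eval_mult [simp]: "mv_eval (f * g) x = mv_eval f x * mv_eval g x"
proof (induction f rule: update_induct)
  case (update f d c)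
  have "mv_eval (Poly_Mapping.single d c * g) x = c * mono_eval x d * mv_eval g x"
  proof (induction g rule: update_induct)
    case (update g e b)
    then show ?case
      by (simp add: update_eq_add_single distrib_left mult_single mono_eval_add algebra_simps)
  qed simp
  with update show ?case
    by (simp add: update_eq_add_single distrib_right)
qed simp

lemma mv_eval_const [simp]: "mv_eval (mv_const c) x = c"
  by (simp add: mv_const_def mono_eval_def)

lemma mv_eval_var [simp]: "mv_eval (mv_var i) x = x i"
  by (simp add: mv_var_def mono_eval_def)

lemma mv_eval_one [simp]: "mv_eval 1 x = 1"
  using mv_eval_const[of 1 x] by (simp add: mv_const_def)

lemma mv_eval_power [simp]: "mv_eval (f ^ n) x = mv_eval f x ^ n"
  by (induction n) simp_all

lemma mv_eval_sum [simp]: "mv_eval (sum f A) x = (\<Sum>i\<in>A. mv_eval (f i) x)"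
  by (induction A rule: infinite_finite_induct) simp_all

lemma mv_eval_prod [simp]: "mv_eval (prod f A) x = (\<Prod>i\<in>A. mv_eval (f i) x)"
  by (induction A rule: infinite_finite_induct) simp_all

section \<open>Closure properties of polynomials and of forms in given variables\<close>

lemma mv_polys_const: "mv_const c \<in> mv_polys I"
  by (simp add: mv_polys_def mv_const_def)

lemma mv_polys_var: "i \<in> I \<Longrightarrow> mv_var i \<in> mv_polys I"
  by (simp add: mv_polys_def mv_var_def)

lemma mv_polys_add: "f \<in> mv_polys I \<Longrightarrow> g \<in> mv_polys I \<Longrightarrow> f + g \<in> mv_polys I"
  using keys_add[of f g] by (auto simp: mv_polys_def)

lemma mv_polys_mult:
  assumes "f \<in> mv_polys I" "g \<in> mv_polys I"
  shows "f * g \<in> mv_polys I"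
  unfolding mv_polys_def
proof safe
  fix e i assume e: "e \<in> Poly_Mapping.keys (f * g)" and i: "i \<in> Poly_Mapping.keys e"
  from e keys_mult[of f g] obtain a b
    where "e = a + b" "a \<in> Poly_Mapping.keys f" "b \<in> Poly_Mapping.keys g"
    by blast
  with i keys_add[of a b] assms show "i \<in> I"
    by (auto simp: mv_polys_def)
qed

lemma mv_polys_power: "f \<in> mv_polys I \<Longrightarrow> f ^ n \<in> mv_polys I"
proof (induction n)
  case 0
  show ?case using mv_polys_const[of 1 I] by (simp add: mv_const_def)
qed (auto intro: mv_polys_mult)

lemma mv_polys_sum: "(\<And>i. i \<in> A \<Longrightarrow> f i \<in> mv_polys I) \<Longrightarrow> sum f A \<in> mv_polys I"
proof (induction A rule: infinite_finite_induct)
  case (insert a A)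
  then show ?case by (auto intro: mv_polys_add)
qed (simp_all add: mv_polys_def)

lemma mv_polys_prod: "(\<And>i. i \<in> A \<Longrightarrow> f i \<in> mv_polys I) \<Longrightarrow> prod f A \<in> mv_polys I"
proof (induction A rule: infinite_finite_induct)
  case (insert a A)
  then show ?case by (auto intro: mv_polys_mult)
qed (simp_all add: mv_polys_def)

lemma hom_polys_const: "mv_const c \<in> hom_polys I 0"
  by (simp add: hom_polys_def mv_polys_const) (simp add: mv_const_def mono_degree_def)

lemma hom_polys_zero: "0 \<in> hom_polys I n"
  by (simp add: hom_polys_def mv_polys_def)

lemma hom_polys_add: "f \<in> hom_polys I n \<Longrightarrow> g \<in> hom_polys I n \<Longrightarrow> f + g \<in> hom_polys I n"
  using keys_add[of f g] by (auto simp: hom_polys_def mv_polys_add)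

lemma hom_polys_mult:
  assumes "f \<in> hom_polys I n" "g \<in> hom_polys I p"
  shows "f * g \<in> hom_polys I (n + p)"
proof -
  have "mono_degree e = n + p" if "e \<in> Poly_Mapping.keys (f * g)" for e
  proof -
    from that keys_mult[of f g] obtain a b
      where "e = a + b" "a \<in> Poly_Mapping.keys f" "b \<in> Poly_Mapping.keys g"
      by blast
    with assms show ?thesis by (auto simp: hom_polys_def mono_degree_add)
  qed
  with assms show ?thesis by (auto simp: hom_polys_def mv_polys_mult)
qed

lemma hom_polys_var: "i \<in> I \<Longrightarrow> mv_var i \<in> hom_polys I 1"
  by (simp add: hom_polys_def mv_polys_var) (simp add: mv_var_def mono_degree_def)


section \<open>Homogeneous polynomial functions\<close>

text \<open>Forms are handled as functions. Over a finite field one function can come from forms of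
  several degrees, so \<open>n\<close> is a degree in which the function can be written. The
  generation by rules lets products and substitutions be treated by induction.\<close>

inductive form_fun :: "nat set \<Rightarrow> nat \<Rightarrow> ((nat \<Rightarrow> 'a::field) \<Rightarrow> 'a) \<Rightarrow> bool" for I where
  const: "form_fun I 0 (\<lambda>x. c)"
| zero: "form_fun I n (\<lambda>x. 0)"
| var_mult: "i \<in> I \<Longrightarrow> form_fun I n F \<Longrightarrow> form_fun I (Suc n) (\<lambda>x. x i * F x)"
| add: "form_fun I n F \<Longrightarrow> form_fun I n G \<Longrightarrow> form_fun I n (\<lambda>x. F x + G x)"

lemma form_fun_var: "i \<in> I \<Longrightarrow> form_fun I 1 (\<lambda>x. x i)"
  using form_fun.var_mult[OF _ form_fun.const[of I 1], of i] by simp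

lemma form_fun_cmult: "form_fun I n F \<Longrightarrow> form_fun I n (\<lambda>x. c * F x)"
proof (induction rule: form_fun.induct)
  case (var_mult i n F)
  then show ?case using form_fun.var_mult[of i I n "\<lambda>x. c * F x"] by (simp add: algebra_simps)
qed (auto intro: form_fun.intros simp: distrib_left)

lemma form_fun_diff:
  "form_fun I n F \<Longrightarrow> form_fun I n G \<Longrightarrow> form_fun I n (\<lambda>x. F x - G x)"
  using form_fun.add[OF _ form_fun_cmult[of I n G "-1"]] by simp

lemma form_fun_mult:
  "form_fun I n F \<Longrightarrow> form_fun I p G \<Longrightarrow> form_fun I (n + p) (\<lambda>x. F x * G x)"
proof (induction rule: form_fun.induct)
  case (var_mult i n F)
  then show ?case
    using form_fun.var_mult[of i I "n + p" "\<lambda>x. F x * G x"] by (simp add: algebra_simps)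
next
  case (add n F H)
  then show ?case
    using form_fun.add[of I "n + p" "\<lambda>x. F x * G x" "\<lambda>x. H x * G x"] by (simp add: algebra_simps)
qed (auto intro: form_fun.intros form_fun_cmult)

lemma form_fun_sum:
  "(\<And>i. i \<in> A \<Longrightarrow> form_fun I n (F i)) \<Longrightarrow> form_fun I n (\<lambda>x. \<Sum>i\<in>A. F i x)"
  by (induction A rule: infinite_finite_induct) (auto intro: form_fun.intros)

lemma form_fun_prod:
  "(\<And>i. i \<in> A \<Longrightarrow> form_fun I (n i) (F i)) \<Longrightarrow> form_fun I (sum n A) (\<lambda>x. \<Prod>i\<in>A. F i x)"
  by (induction A rule: infinite_finite_induct) (auto intro: form_fun.const form_fun_mult)

lemma form_fun_power: "form_fun I n F \<Longrightarrow> form_fun I (n * p) (\<lambda>x. F x ^ p)"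
  by (induction p) (auto intro: form_fun.const form_fun_mult)

text \<open>Serves for linear changes of coordinates: a change of basis of a plane, and the shift of
  variables in a cone.\<close>

lemma form_fun_substitute:
  assumes "form_fun I n F" "\<And>i. i \<in> I \<Longrightarrow> form_fun J 1 (\<lambda>x. g x i)"
  shows "form_fun J n (\<lambda>x. F (g x))"
  using assms
proof (induction rule: form_fun.induct)
  case (var_mult i n F)
  then show ?case using form_fun_mult[of J 1 "\<lambda>x. g x i" n "\<lambda>x. F (g x)"] by simp
qed (auto intro: form_fun.intros)

lemma form_fun_cong_args:
  assumes "form_fun I n F" "\<And>i. i \<in> I \<Longrightarrow> x i = y i"
  shows "F x = F y"
  using assms by (induction rule: form_fun.induct) auto

lemma form_fun_homogeneous:
  assumes "form_fun I n F"
  shows "F (\<lambda>i. c * x i) = c ^ n * F x"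
  using assms by (induction rule: form_fun.induct) (auto simp: algebra_simps)

text \<open>The link between forms as functions and the polynomials in the definitions of the codes:
  each rule of \<open>form_fun\<close> is matched by an operation on polynomials, and conversely a
  polynomial is a sum of monomials, each a product of powers of variables.\<close>

lemma form_fun_iff_hom_polys: "form_fun I n F \<longleftrightarrow> (\<exists>f\<in>hom_polys I n. F = mv_eval f)"
proof
  assume "form_fun I n F"
  then show "\<exists>f\<in>hom_polys I n. F = mv_eval f"
  proof (induction rule: form_fun.induct)
    case (const c)
    show ?case by (rule bexI[OF _ hom_polys_const[of c]]) auto
  next
    case (zero n)
    show ?case by (rule bexI[OF _ hom_polys_zero]) auto
  next
    case (var_mult i n F)
    then obtain f where "f \<in> hom_polys I n" "F = mv_eval f" by blast
    with hom_polys_mult[OF hom_polys_var[OF var_mult(1)], of f n] show ?case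
      by (intro bexI[of _ "mv_var i * f"]) auto
  next
    case (add n F G)
    then obtain f g where "f \<in> hom_polys I n" "F = mv_eval f" "g \<in> hom_polys I n" "G = mv_eval g"
      by blast
    then show ?case by (intro bexI[of _ "f + g"]) (auto intro: hom_polys_add)
  qed
next
  assume "\<exists>f\<in>hom_polys I n. F = mv_eval f"
  then obtain f where f: "f \<in> hom_polys I n" and F: "F = mv_eval f" by blast
  have "form_fun I n (\<lambda>x. \<Sum>e\<in>Poly_Mapping.keys f. Poly_Mapping.lookup f e * mono_eval x e)"
  proof (intro form_fun_sum form_fun_cmult)
    fix e assume "e \<in> Poly_Mapping.keys f"
    with f have e: "Poly_Mapping.keys e \<subseteq> I" "mono_degree e = n"
      by (auto simp: hom_polys_def mv_polys_def)
    have "form_fun I (\<Sum>i\<in>Poly_Mapping.keys e. Poly_Mapping.lookup e i)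
        (\<lambda>x. \<Prod>i\<in>Poly_Mapping.keys e. x i ^ Poly_Mapping.lookup e i)"
    proof (rule form_fun_prod)
      fix i assume "i \<in> Poly_Mapping.keys e"
      with e have "form_fun I (1 * Poly_Mapping.lookup e i) (\<lambda>x. x i ^ Poly_Mapping.lookup e i)"
        by (intro form_fun_power form_fun_var) auto
      then show "form_fun I (Poly_Mapping.lookup e i) (\<lambda>x. x i ^ Poly_Mapping.lookup e i)" by simp
    qed
    with e show "form_fun I n (\<lambda>x. mono_eval x e)"
      by (simp add: mono_degree_def mono_eval_def)
  qed
  with F show "form_fun I n F" by (simp add: mv_eval_altdef[abs_def])
qed

lemma binary_form_explicit:
  assumes "form_fun {0, 1} n F"
  shows "\<exists>c. \<forall>x. F x = (\<Sum>i\<le>n. c i * x 0 ^ i * x 1 ^ (n - i))"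
  using assms
proof (induction rule: form_fun.induct)
  case (const c)
  show ?case by (rule exI[of _ "\<lambda>_. c"]) simp
next
  case (zero n)
  show ?case by (rule exI[of _ "\<lambda>_. 0"]) simp
next
  case (var_mult j n F)
  then obtain c where c: "\<And>x. F x = (\<Sum>i\<le>n. c i * x 0 ^ i * x 1 ^ (n - i))" by blast
  show ?case
  proof (cases "j = 0")
    case True
    \<comment> \<open>Multiplication by \<open>x 0\<close> shifts the coefficients up by one index;
      multiplication by \<open>x 1\<close> keeps them and leaves 0 as the new top
      coefficient.\<close>
    then show ?thesis
      by (intro exI[of _ "case_nat 0 c"])
        (simp add: c sum.atMost_Suc_shift sum_distrib_left algebra_simps del: sum.atMost_Suc)
  next
    case False
    with var_mult have "j = 1" by simp
    have "(\<Sum>i\<le>n. (c(Suc n := 0)) i * x 0 ^ i * x 1 ^ (Suc n - i)) =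
        (\<Sum>i\<le>n. x 1 * (c i * x 0 ^ i * x 1 ^ (n - i)))" for x :: "nat \<Rightarrow> 'a"
      by (rule sum.cong) (auto simp: Suc_diff_le)
    with \<open>j = 1\<close> show ?thesis
      by (intro exI[of _ "c(Suc n := 0)"]) (simp add: c sum_distrib_left)
  qed
next
  case (add n F G)
  then obtain c d where "\<And>x. F x = (\<Sum>i\<le>n. c i * x 0 ^ i * x 1 ^ (n - i))"
    "\<And>x. G x = (\<Sum>i\<le>n. d i * x 0 ^ i * x 1 ^ (n - i))"
    by blast
  then show ?case
    by (intro exI[of _ "\<lambda>i. c i + d i"]) (simp add: sum.distrib algebra_simps)
qed

text \<open>The function is s^n g(t/s) with s = \<open>x i\<close> and t = \<open>x j\<close>,
  multiplied out.\<close>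

lemma binary_form_homogenization:
  assumes "degree g < n" "i \<in> I" "j \<in> I"
  shows "form_fun I n (\<lambda>x. \<Sum>d\<le>degree g. coeff g d * (x i ^ (n - d) * x j ^ d))"
proof (intro form_fun_sum form_fun_cmult)
  fix d assume "d \<in> {..degree g}"
  with assms have "form_fun I (1 * (n - d) + 1 * d) (\<lambda>x. x i ^ (n - d) * x j ^ d)"
    by (intro form_fun_mult form_fun_power form_fun_var)
  with \<open>d \<in> _\<close> assms show "form_fun I n (\<lambda>x. x i ^ (n - d) * x j ^ d)" by simp
qed

text \<open>As the degree is strictly below \<open>n\<close>, every term keeps a positive power of
  \<open>s\<close>; hence the value 0 at \<open>s = 0\<close>.\<close>

lemma homogenization_eval:
  fixes g :: "'a::field poly"
  assumes "degree g < n"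
  shows "(\<Sum>d\<le>degree g. coeff g d * (s ^ (n - d) * t ^ d)) =
    (if s = 0 then 0 else s ^ n * poly g (t / s))"
proof (cases "s = 0")
  case True
  with assms show ?thesis by (auto intro!: sum.neutral)
next
  case False
  have "coeff g d * (s ^ (n - d) * t ^ d) = s ^ n * (coeff g d * (t / s) ^ d)"
    if "d \<le> degree g" for d
    using that assms False by (simp add: power_diff power_divide)
  then have "(\<Sum>d\<le>degree g. coeff g d * (s ^ (n - d) * t ^ d)) =
      (\<Sum>d\<le>degree g. s ^ n * (coeff g d * (t / s) ^ d))"
    by (intro sum.cong) simp_all
  with False show ?thesis by (simp add: poly_altdef sum_distrib_left)
qed

declare One_nat_def [simp del]

section \<open>Finite fields and finite spaces of functions\<close>

text \<open>Multiplication by \<open>a\<close> permutes the nonzero elements, so their product,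
  which is not 0, is unchanged when multiplied by a^(q-1).\<close>

lemma finite_field_power_card_minus_1:
  fixes a :: "'a::{field,finite}"
  assumes "a \<noteq> 0"
  shows "a ^ (CARD('a) - 1) = 1"
proof -
  let ?U = "UNIV - {0::'a}"
  have "bij_betw ((*) a) ?U ?U"
    by (rule bij_betw_byWitness[of _ "\<lambda>x. x / a"]) (use assms in auto)
  then have "(\<Prod>x\<in>?U. x) = (\<Prod>x\<in>?U. a * x)"
    by (rule prod.reindex_bij_betw[symmetric])
  also have "\<dots> = a ^ (CARD('a) - 1) * (\<Prod>x\<in>?U. x)"
    by (simp add: prod.distrib card_Diff_singleton)
  finally show ?thesis by (simp add: prod_zero_iff)
qed

lemma card_field_ge_2: "2 \<le> CARD('a::{field,finite})"
  using card_mono[of "UNIV :: 'a set" "{0, 1}"] by simp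

lemma power_card_minus_1: "(a::'a::{field,finite}) ^ (CARD('a) - 1) = (if a = 0 then 0 else 1)"
  using card_field_ge_2[where 'a='a] by (simp add: finite_field_power_card_minus_1)

lemma power_card: "(a::'a::{field,finite}) ^ CARD('a) = a"
proof -
  have "a ^ CARD('a) = a * a ^ (CARD('a) - 1)"
    by (metis One_nat_def Suc_pred power_Suc zero_less_card_finite)
  then show ?thesis by (simp add: power_card_minus_1)
qed

text \<open>Under scaling of its argument, a form of degree k + n(q-1) therefore behaves like one of
  degree k. For \<open>c = 0\<close> both powers vanish because k is positive.\<close>

lemma power_add_mult_card_minus_1:
  fixes c :: "'a::{field,finite}"
  assumes "1 \<le> k"
  shows "c ^ (k + n * (CARD('a) - 1)) = c ^ k"
  using assms
  by (cases "c = 0") (simp_all add: power_add power_mult mult.commute[of n] finite_field_power_card_minus_1)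

text \<open>The indicator of the zero vector, given by a polynomial; this is the source of all
  interpolation formulas below.\<close>

lemma prod_one_minus_power_card:
  fixes z :: "'i \<Rightarrow> 'a::{field,finite}"
  assumes "finite S"
  shows "(\<Prod>i\<in>S. 1 - z i ^ (CARD('a) - 1)) = (if \<forall>i\<in>S. z i = 0 then 1 else 0)"
  using assms by (auto simp: power_card_minus_1)

text \<open>Coordinates with respect to a basis \<open>B\<close> identify \<open>V\<close> with the
  functions from \<open>B\<close> to the field; independence makes \<open>comb\<close> injective,
  spanning makes it surjective.\<close>

lemma card_subspace:
  fixes V :: "('i \<Rightarrow> 'a::{field,finite}) set"
  assumes "word.subspace V" "finite V"
  shows "card V = CARD('a) ^ word.dim V"
proof -
  obtain B where B: "B \<subseteq> V" "word.independent B" "V \<subseteq> word.span B" "card B = word.dim V"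
    using word.basis_exists by blast
  then have fin: "finite B"
    using assms(2) finite_subset by blast
  define comb where "comb u = (\<Sum>v\<in>B. fun_scale (u v) v)" for u :: "('i \<Rightarrow> 'a) \<Rightarrow> 'a"
  have "bij_betw comb (B \<rightarrow>\<^sub>E UNIV) V"
  proof (rule bij_betwI')
    fix u w :: "('i \<Rightarrow> 'a) \<Rightarrow> 'a"
    assume uw: "u \<in> B \<rightarrow>\<^sub>E UNIV" "w \<in> B \<rightarrow>\<^sub>E UNIV"
    show "comb u = comb w \<longleftrightarrow> u = w"
    proof
      assume "comb u = comb w"
      then have "(\<Sum>v\<in>B. fun_scale (u v - w v) v) = 0"
        by (simp add: comb_def word.scale_left_diff_distrib sum_subtractf)
      then have "u v = w v" if "v \<in> B" for v
        using word.independentD[OF B(2) fin order_refl, of "\<lambda>v. u v - w v"] that by force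
      then show "u = w" using uw by (intro PiE_ext) auto
    qed simp
  next
    fix u assume "u \<in> B \<rightarrow>\<^sub>E (UNIV :: 'a set)"
    show "comb u \<in> V"
      unfolding comb_def using assms(1) B(1)
      by (intro word.subspace_sum word.subspace_scale) auto
  next
    fix v assume "v \<in> V"
    then have "v \<in> word.span B" using B(3) by blast
    then obtain u where "v = (\<Sum>b\<in>B. fun_scale (u b) b)"
      by (auto simp: word.span_finite[OF fin])
    then show "\<exists>u\<in>B \<rightarrow>\<^sub>E UNIV. v = comb u"
      by (intro bexI[of _ "restrict u B"]) (auto simp: comb_def)
  qed
  then have "card V = card (B \<rightarrow>\<^sub>E (UNIV :: 'a set))"
    by (simp add: bij_betw_same_card)
  with B(4) fin show ?thesis by (simp add: card_funcsetE)
qed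

lemma finite_functions_supported_in:
  fixes S :: "('i \<Rightarrow> 'a::{zero,finite}) set"
  assumes "finite A" "\<And>F x. F \<in> S \<Longrightarrow> x \<notin> A \<Longrightarrow> F x = 0"
  shows "finite S"
  by (rule finite_subset[OF _ finite_set_of_finite_funs[OF assms(1) finite[of UNIV], of 0]])
    (use assms(2) in auto)

lemma finite_vecs: "finite I \<Longrightarrow> finite (vecs I :: (nat \<Rightarrow> 'a::{field,finite}) set)"
  by (rule finite_functions_supported_in[of I]) (auto simp: vecs_def)


section \<open>Functions that are forms on all planes, or polynomials on all lines\<close>

text \<open>The vectors \<open>u\<close> and \<open>v\<close> may be dependent, so the condition
  passes through every linear map, injective or not. The values outside \<open>vecs {0..m}\<close>
  are fixed, which makes the space finite over a finite field.\<close>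

definition plane_forms :: "nat \<Rightarrow> nat \<Rightarrow> ((nat \<Rightarrow> 'a::field) \<Rightarrow> 'a) set" where
  "plane_forms m k = {F. (\<forall>x. x \<notin> vecs {0..m} \<longrightarrow> F x = 0) \<and>
     (\<forall>u\<in>vecs {0..m}. \<forall>v\<in>vecs {0..m}. form_fun {0, 1} k (\<lambda>x. F (\<lambda>i. x 0 * u i + x 1 * v i)))}"

definition line_polys :: "nat \<Rightarrow> nat \<Rightarrow> ((nat \<Rightarrow> 'a::field) \<Rightarrow> 'a) set" where
  "line_polys m d = {F. (\<forall>x. x \<notin> vecs {1..m} \<longrightarrow> F x = 0) \<and>
     (\<forall>a\<in>vecs {1..m}. \<forall>b\<in>vecs {1..m}. \<exists>g. degree g \<le> d \<and> (\<forall>t. F (\<lambda>i. a i + t * b i) = poly g t))}"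

lemma plane_forms_outside: "F \<in> plane_forms m k \<Longrightarrow> x \<notin> vecs {0..m} \<Longrightarrow> F x = 0"
  by (simp add: plane_forms_def)

lemma plane_forms_form:
  "F \<in> plane_forms m k \<Longrightarrow> u \<in> vecs {0..m} \<Longrightarrow> v \<in> vecs {0..m} \<Longrightarrow>
    form_fun {0, 1} k (\<lambda>x. F (\<lambda>i. x 0 * u i + x 1 * v i))"
  by (simp add: plane_forms_def)

lemma line_polys_outside: "F \<in> line_polys m d \<Longrightarrow> x \<notin> vecs {1..m} \<Longrightarrow> F x = 0"
  by (simp add: line_polys_def)

lemma line_polys_line:
  assumes "F \<in> line_polys m d" "a \<in> vecs {1..m}" "b \<in> vecs {1..m}"
  shows "\<exists>g. degree g \<le> d \<and> (\<forall>t. F (\<lambda>i. a i + t * b i) = poly g t)"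
  using assms by (simp add: line_polys_def)

text \<open>The degenerate pair \<open>x\<close>, 0 already carries this: on it the binary form is
  evaluated at (c, c) and at (1, 1).\<close>

lemma plane_forms_homogeneous:
  assumes "F \<in> plane_forms m k" "x \<in> vecs {0..m}"
  shows "F (\<lambda>i. c * x i) = c ^ k * F x"
proof -
  have "0 \<in> vecs {0..m}" by (simp add: vecs_def)
  from form_fun_homogeneous[OF plane_forms_form[OF assms this], of c "\<lambda>_. 1"]
  show ?thesis by simp
qed

lemma plane_forms_add: "F \<in> plane_forms m k \<Longrightarrow> G \<in> plane_forms m k \<Longrightarrow> (\<lambda>x. F x + G x) \<in> plane_forms m k"
  by (simp add: plane_forms_def form_fun.add)

lemma plane_forms_diff: "F \<in> plane_forms m k \<Longrightarrow> G \<in> plane_forms m k \<Longrightarrow> (\<lambda>x. F x - G x) \<in> plane_forms m k"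
  by (simp add: plane_forms_def form_fun_diff)

lemma plane_forms_cmult: "F \<in> plane_forms m k \<Longrightarrow> (\<lambda>x. c * F x) \<in> plane_forms m k"
  by (simp add: plane_forms_def form_fun_cmult)

lemma finite_plane_forms: "finite (plane_forms m k :: ((nat \<Rightarrow> 'a::{field,finite}) \<Rightarrow> 'a) set)"
  by (rule finite_functions_supported_in[of "vecs {0..m}"])
    (auto intro: finite_vecs plane_forms_outside)

text \<open>In a single coordinate the only candidates are c x^k, and c is the value at the unit
  vector. This one-dimensional space accounts for the summand 1 in the dimension formula.\<close>

lemma card_plane_forms_0: "card (plane_forms 0 k :: ((nat \<Rightarrow> 'a::{field,finite}) \<Rightarrow> 'a) set) = CARD('a)"
proof -
  have unit: "(unit_vec 0 :: nat \<Rightarrow> 'a) \<in> vecs {0..0}" by (simp add: vecs_def unit_vec_def)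
  have vec: "x = (\<lambda>i. x 0 * unit_vec 0 i)" if "x \<in> vecs {0..0}" for x :: "nat \<Rightarrow> 'a"
    using that by (auto simp: vecs_def unit_vec_def)
  define power where "power c x = (if x \<in> vecs {0..0} then c * x 0 ^ k else 0)"
    for c :: 'a and x :: "nat \<Rightarrow> 'a"
  have power_mem: "power c \<in> plane_forms 0 k" for c
  proof -
    have "form_fun {0, 1} k (\<lambda>x. power c (\<lambda>i. x 0 * u i + x 1 * v i))"
      if "u \<in> vecs {0..0}" "v \<in> vecs {0..0}" for u v :: "nat \<Rightarrow> 'a"
    proof -
      have "form_fun {0, 1} (1 * k) (\<lambda>x. (u 0 * x 0 + v 0 * x 1) ^ k)"
        by (intro form_fun_power form_fun.add form_fun_cmult form_fun_var) auto
      moreover have "(\<lambda>i. x 0 * u i + x 1 * v i) \<in> vecs {0..0}" for x :: "nat \<Rightarrow> 'a"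
        using that by (simp add: vecs_def)
      ultimately show ?thesis by (simp add: power_def form_fun_cmult mult.commute)
    qed
    then show ?thesis by (simp add: plane_forms_def power_def)
  qed
  have "bij_betw (\<lambda>F. F (unit_vec 0)) (plane_forms 0 k) (UNIV :: 'a set)"
  proof (rule bij_betw_byWitness[of _ power])
    show "\<forall>F\<in>plane_forms 0 k. power (F (unit_vec 0)) = F"
    proof (intro ballI ext)
      fix F :: "(nat \<Rightarrow> 'a) \<Rightarrow> 'a" and x assume F: "F \<in> plane_forms 0 k"
      show "power (F (unit_vec 0)) x = F x"
      proof (cases "x \<in> vecs {0..0}")
        case True
        have "F x = F (\<lambda>i. x 0 * unit_vec 0 i)" by (rule arg_cong[OF vec[OF True]])
        with True show ?thesis
          by (simp add: plane_forms_homogeneous[OF F unit] power_def)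
      qed (use F in \<open>simp add: power_def plane_forms_def\<close>)
    qed
    have "unit_vec 0 0 = (1 :: 'a)" by (simp add: unit_vec_def)
    then show "\<forall>c\<in>UNIV. power c (unit_vec 0) = c" using unit by (simp add: power_def)
  qed (use power_mem in auto)
  then show ?thesis by (rule bij_betw_same_card)
qed

section \<open>Cones and hyperplane sections\<close>

lemma vecs_1_iff: "x \<in> vecs {1..m} \<longleftrightarrow> x \<in> vecs {0..m} \<and> x 0 = 0"
proof -
  have "i \<notin> {1..m} \<longleftrightarrow> i = 0 \<or> i \<notin> {0..m}" for i by auto
  then show ?thesis by (auto simp: vecs_def)
qed

text \<open>Dropping coordinate 0 is the projection from the vertex (1, 0, ..., 0). It is linear;
  planes through the vertex become degenerate pairs, which \<open>plane_forms\<close>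
  admits.\<close>

lemma plane_forms_cone:
  assumes "G \<in> plane_forms m k"
  shows "(\<lambda>x. G (\<lambda>i. x (Suc i))) \<in> plane_forms (Suc m) k"
proof -
  have vecs_Suc: "x \<in> vecs {0..Suc m} \<longleftrightarrow> (\<lambda>i. x (Suc i)) \<in> vecs {0..m}" for x :: "nat \<Rightarrow> 'a"
    unfolding vecs_def by (simp add: not_le) (metis Suc_less_eq Suc_lessE)
  show ?thesis
    using assms by (auto simp: plane_forms_def vecs_Suc)
qed

text \<open>The map \<open>case_nat 0\<close> embeds the smaller space linearly as the hyperplane
  where coordinate 0 vanishes.\<close>

lemma plane_forms_hyperplane:
  assumes "F \<in> plane_forms (Suc m) k"
  shows "(\<lambda>x. F (case_nat 0 x)) \<in> plane_forms m k"
proof -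
  have vecs_Suc: "case_nat 0 x \<in> vecs {0..Suc m} \<longleftrightarrow> x \<in> vecs {0..m}" for x :: "nat \<Rightarrow> 'a"
    by (auto simp: vecs_def split: nat.splits)
  have "form_fun {0, 1} k (\<lambda>x. F (case_nat 0 (\<lambda>i. x 0 * u i + x 1 * v i)))"
    if "u \<in> vecs {0..m}" "v \<in> vecs {0..m}" for u v
  proof -
    have "case_nat 0 (\<lambda>i. x 0 * u i + x 1 * v i) =
        (\<lambda>i. x 0 * case_nat 0 u i + x 1 * case_nat 0 v i)" for x :: "nat \<Rightarrow> 'a"
      by (auto split: nat.splits)
    with plane_forms_form[OF assms, of "case_nat 0 u" "case_nat 0 v"] that show ?thesis
      by (simp add: vecs_Suc)
  qed
  with assms show ?thesis by (simp add: plane_forms_def vecs_Suc)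
qed

section \<open>Affine words as the plane forms that vanish at infinity\<close>

definition homogenize :: "nat \<Rightarrow> ((nat \<Rightarrow> 'a::field) \<Rightarrow> 'a) \<Rightarrow> (nat \<Rightarrow> 'a) \<Rightarrow> 'a" where
  "homogenize k A x = (if x 0 = 0 then 0 else x 0 ^ k * A (\<lambda>i. if i = 0 then 0 else x i / x 0))"

lemma affine_chart_in_vecs_iff:
  assumes "x 0 \<noteq> 0"
  shows "(\<lambda>i. if i = 0 then 0 else x i / x 0) \<in> vecs {1..m} \<longleftrightarrow> x \<in> vecs {0..m}"
proof -
  have "i \<notin> {0..m} \<longrightarrow> (if i = 0 then 0 else x i / x 0) = 0 \<longleftrightarrow> i \<notin> {0..m} \<longrightarrow> x i = 0" for i
    using assms by simp
  then show ?thesis by (simp add: vecs_1_iff) (simp add: vecs_def)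
qed

text \<open>On a plane spanned by \<open>u\<close> off the hyperplane at infinity and
  \<open>w\<close> in it, the function is the homogenization of the polynomial that \<open>A\<close>
  induces on an affine line; its degree is below \<open>k\<close>, so the value 0 at infinity fits.
  A change of basis brings every other plane not inside the hyperplane to this shape, and inside it
  the function is 0.\<close>

lemma homogenize_plane_forms:
  assumes A: "A \<in> line_polys m (k - 1)" and k: "1 \<le> k"
  shows "homogenize k A \<in> plane_forms m k"
proof -
  have outside: "homogenize k A x = 0" if "x \<notin> vecs {0..m}" for x
  proof (cases "x 0 = 0")
    case False
    with that have "A (\<lambda>i. if i = 0 then 0 else x i / x 0) = 0"
      by (intro line_polys_outside[OF A]) (simp add: affine_chart_in_vecs_iff)
    then show ?thesis by (simp add: homogenize_def)
  qed (simp add: homogenize_def)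
  have transversal: "form_fun {0, 1} k (\<lambda>x. homogenize k A (\<lambda>i. x 0 * u i + x 1 * w i))"
    if "u \<in> vecs {0..m}" "w \<in> vecs {0..m}" "u 0 \<noteq> 0" "w 0 = 0" for u w
  proof -
    \<comment> \<open>The affine line cut out by the plane in the chart: as \<open>w 0 = 0\<close>,
      the vector s u + t w has coordinate \<open>s * u 0\<close> at index 0 and represents the point
      with parameter t/s.\<close>
    define a b where "a i = (if i = 0 then 0 else u i / u 0)" and "b i = w i / u 0" for i
    have "a \<in> vecs {1..m}" "b \<in> vecs {1..m}"
      unfolding vecs_1_iff using that by (simp_all add: vecs_def a_def b_def)
    from line_polys_line[OF A this] obtain g
      where g: "degree g \<le> k - 1 \<and> (\<forall>t. A (\<lambda>i. a i + t * b i) = poly g t)" ..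
    then have "degree g \<le> k - 1" by blast
    with k have deg: "degree g < k" by linarith
    have "homogenize k A (\<lambda>i. s * u i + t * w i) =
        u 0 ^ k * (\<Sum>d\<le>degree g. coeff g d * (s ^ (k - d) * t ^ d))" for s t
    proof (cases "s = 0")
      case True
      with that show ?thesis by (simp add: homogenize_def homogenization_eval[OF deg])
    next
      case False
      have "(\<lambda>i. if i = 0 then 0 else (s * u i + t * w i) / (s * u 0)) = (\<lambda>i. a i + t / s * b i)"
      proof
        fix i
        show "(if i = 0 then 0 else (s * u i + t * w i) / (s * u 0)) = a i + t / s * b i"
          using False that by (cases "i = 0") (simp_all add: a_def b_def add_divide_distrib)
      qed
      moreover have "homogenize k A (\<lambda>i. s * u i + t * w i) =
          (s * u 0) ^ k * A (\<lambda>i. if i = 0 then 0 else (s * u i + t * w i) / (s * u 0))"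
        using False that by (simp add: homogenize_def cong: if_cong)
      ultimately have "homogenize k A (\<lambda>i. s * u i + t * w i) = (s * u 0) ^ k * poly g (t / s)"
        using g by metis
      with False show ?thesis by (simp add: homogenization_eval[OF deg] power_mult_distrib)
    qed
    then show ?thesis
      by (simp only:) (intro form_fun_cmult binary_form_homogenization[OF deg]; simp)
  qed
  have nonzero: "form_fun {0, 1} k (\<lambda>x. homogenize k A (\<lambda>i. x 0 * u i + x 1 * v i))"
    if uv: "u \<in> vecs {0..m}" "v \<in> vecs {0..m}" "u 0 \<noteq> 0" for u v
  proof -
    \<comment> \<open>The constant puts \<open>w\<close> = v - c u at infinity, and
      \<open>sub\<close> is the change of coordinates s u + t v = (s + c t) u + t w.\<close>
    define c where "c = v 0 / u 0"
    define w where "w i = v i - c * u i" for i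
    define sub where "sub x i = (if i = 0 then x 0 + c * x 1 else x 1)" for x :: "nat \<Rightarrow> 'a" and i :: nat
    have "form_fun {0, 1} k (\<lambda>x. homogenize k A (\<lambda>i. x 0 * u i + x 1 * w i))"
      using uv by (intro transversal) (auto simp: vecs_def w_def c_def)
    moreover have "form_fun {0, 1} 1 (\<lambda>x. sub x i)" if "i \<in> {0, 1}" for i
    proof -
      have "form_fun {0, 1} 1 (\<lambda>x :: nat \<Rightarrow> 'a. x 0 + c * x 1)" "form_fun {0, 1} 1 (\<lambda>x :: nat \<Rightarrow> 'a. x 1)"
        by (intro form_fun.add form_fun_cmult form_fun_var; simp)+
      with that show ?thesis by (auto simp: sub_def)
    qed
    ultimately have "form_fun {0, 1} k (\<lambda>x. homogenize k A (\<lambda>i. sub x 0 * u i + sub x 1 * w i))"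
      by (rule form_fun_substitute[where g = sub])
    then show ?thesis by (simp add: sub_def w_def algebra_simps)
  qed
  have "form_fun {0, 1} k (\<lambda>x. homogenize k A (\<lambda>i. x 0 * u i + x 1 * v i))"
    if uv: "u \<in> vecs {0..m}" "v \<in> vecs {0..m}" for u v
  proof -
    consider "u 0 \<noteq> 0" | "v 0 \<noteq> 0" | "u 0 = 0" "v 0 = 0" by blast
    then show ?thesis
    proof cases
      case 1
      with uv show ?thesis by (rule nonzero)
    next
      case 2
      define swap where "swap x i = (if i = 0 then x 1 else x 0)" for x :: "nat \<Rightarrow> 'a" and i :: nat
      have "form_fun {0, 1} k (\<lambda>x. homogenize k A (\<lambda>i. swap x 0 * v i + swap x 1 * u i))"
        by (rule form_fun_substitute[where g = swap, OF nonzero[OF uv(2,1) 2]])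
          (auto simp: swap_def intro: form_fun_var)
      then show ?thesis by (simp add: swap_def add.commute)
    qed (simp add: homogenize_def form_fun.zero)
  qed
  with outside show ?thesis by (simp add: plane_forms_def)
qed

text \<open>The word \<open>A\<close> is the restriction of \<open>F\<close> to the chart where
  coordinate 0 equals 1. On the plane of a line with direction \<open>b\<close>, the coefficient
  that would produce degree \<open>k\<close> is the value of \<open>F\<close> at the infinite point
  \<open>b\<close>, which is 0.\<close>

lemma plane_forms_vanishing_at_infinity:
  assumes F: "F \<in> plane_forms m k" and k: "1 \<le> k" and vanish: "\<And>x. x 0 = 0 \<Longrightarrow> F x = 0"
  obtains A where "A \<in> line_polys m (k - 1)" "F = homogenize k A"
proof
  define A where "A = (\<lambda>y. if y \<in> vecs {1..m} then F (y(0 := 1)) else 0)"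
  have "\<exists>g. degree g \<le> k - 1 \<and> (\<forall>t. A (\<lambda>i. a i + t * b i) = poly g t)"
    if "a \<in> vecs {1..m}" "b \<in> vecs {1..m}" for a b
  proof -
    \<comment> \<open>The line a + t b lies in the chart as (1, a) + t (0, b), so \<open>F\<close>
      on it comes from the plane spanned by these two vectors.\<close>
    have "a(0 := 1) \<in> vecs {0..m}" "b \<in> vecs {0..m}"
      using that by (auto simp: vecs_def)
    from binary_form_explicit[OF plane_forms_form[OF F this]] obtain c where
      "\<forall>x :: nat \<Rightarrow> 'a. F (\<lambda>i. x 0 * (a(0 := 1)) i + x 1 * b i) = (\<Sum>i\<le>k. c i * x 0 ^ i * x 1 ^ (k - i))" ..
    note c = this[rule_format]
    have b0: "b 0 = 0" using that by (auto simp: vecs_def)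
    \<comment> \<open>Evaluation at (0, 1) isolates \<open>c 0\<close>, the coefficient of the pure
      power of the second coordinate.\<close>
    have "F b = (\<Sum>i\<le>k. c i * 0 ^ i)"
      using c[of "\<lambda>i. if i = 0 then 0 else 1"] by simp
    also have "\<dots> = c 0" by (simp add: power_0_left if_distrib sum.delta cong: if_cong)
    finally have c0: "c 0 = 0" using vanish[of b, OF b0] by simp
    \<comment> \<open>With the first coordinate set to 1, index i contributes degree k - i; leaving
      out i = 0 lowers the bound to k - 1.\<close>
    define g where "g = (\<Sum>i\<in>{1..k}. monom (c i) (k - i))"
    have "degree g \<le> k - 1"
      unfolding g_def by (intro degree_sum_le) (auto intro: order_trans[OF degree_monom_le])
    moreover have "A (\<lambda>i. a i + t * b i) = poly g t" for t
    proof -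
      have "(\<lambda>i. a i + t * b i)(0 := 1) = (\<lambda>i. (a(0 := 1)) i + t * b i)"
        using b0 by auto
      then have "A (\<lambda>i. a i + t * b i) = F (\<lambda>i. (a(0 := 1)) i + t * b i)"
        using that by (auto simp: A_def vecs_def)
      also have "\<dots> = (\<Sum>i\<le>k. c i * t ^ (k - i))"
        using c[of "\<lambda>i. if i = 0 then 1 else t"] by simp
      also have "\<dots> = (\<Sum>i\<in>{1..k}. c i * t ^ (k - i))"
        by (rule sum.mono_neutral_right) (use c0 in \<open>auto simp: not_le\<close>)
      also have "\<dots> = poly g t" by (simp add: g_def poly_sum poly_monom)
      finally show ?thesis .
    qed
    ultimately show ?thesis by (intro exI[of _ g] conjI allI)
  qed
  then show "A \<in> line_polys m (k - 1)" by (simp add: line_polys_def A_def)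
  show "F = homogenize k A"
  proof
    fix x :: "nat \<Rightarrow> 'a"
    consider "x 0 = 0" | "x 0 \<noteq> 0" "x \<in> vecs {0..m}" | "x 0 \<noteq> 0" "x \<notin> vecs {0..m}" by blast
    then show "F x = homogenize k A x"
    proof cases
      case 1
      then show ?thesis using vanish by (simp add: homogenize_def)
    next
      case 2
      \<comment> \<open>The multiple of \<open>x\<close> in the chart; homogeneity carries the value
        there back to \<open>x\<close>.\<close>
      define y where "y i = x i / x 0" for i
      have y: "y \<in> vecs {0..m}" "x = (\<lambda>i. x 0 * y i)"
        "(\<lambda>i. if i = 0 then 0 else x i / x 0) \<in> vecs {1..m}"
        "(\<lambda>i. if i = 0 then 0 else x i / x 0)(0 := 1) = y"
        using 2 by (auto simp: vecs_def y_def)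
      have "F x = F (\<lambda>i. x 0 * y i)" by (rule arg_cong[OF y(2)])
      also have "\<dots> = x 0 ^ k * F y" by (rule plane_forms_homogeneous[OF F y(1)])
      finally have "F x = x 0 ^ k * F y" .
      with y(3,4) 2 show ?thesis by (simp add: homogenize_def A_def)
    next
      case 3
      then have "(\<lambda>i. if i = 0 then 0 else x i / x 0) \<notin> vecs {1..m}"
        by (simp add: affine_chart_in_vecs_iff)
      with 3 plane_forms_outside[OF F] show ?thesis by (simp add: homogenize_def A_def)
    qed
  qed
qed

text \<open>\<open>G\<close> is the restriction to the hyperplane at infinity. Subtracting the cone
  over \<open>G\<close> leaves a plane form that vanishes there, hence a homogenized affine
  word.\<close>

lemma plane_forms_decompose:
  assumes F: "F \<in> plane_forms (Suc m) k" and k: "1 \<le> k"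
  obtains G A where "G \<in> plane_forms m k" "A \<in> line_polys (Suc m) (k - 1)"
    "F = (\<lambda>x. G (\<lambda>i. x (Suc i)) + homogenize k A x)"
proof -
  define G where "G = (\<lambda>x. F (case_nat 0 x))"
  have G: "G \<in> plane_forms m k"
    unfolding G_def by (rule plane_forms_hyperplane[OF F])
  have "G (\<lambda>i. x (Suc i)) = F x" if "x 0 = 0" for x
  proof -
    have "case_nat 0 (\<lambda>i. x (Suc i)) = x" using that by (auto split: nat.splits)
    then show ?thesis by (simp add: G_def)
  qed
  then have "F x - G (\<lambda>i. x (Suc i)) = 0" if "x 0 = 0" for x using that by simp
  then obtain A where A: "A \<in> line_polys (Suc m) (k - 1)"
    "(\<lambda>x. F x - G (\<lambda>i. x (Suc i))) = homogenize k A"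
    by (rule plane_forms_vanishing_at_infinity[OF plane_forms_diff[OF F plane_forms_cone[OF G]] k])
  from A(2) have "F = (\<lambda>x. G (\<lambda>i. x (Suc i)) + homogenize k A x)"
    by (auto simp: fun_eq_iff algebra_simps)
  then show ?thesis by (rule that[OF G A(1)])
qed

lemma card_plane_forms_Suc:
  assumes k: "1 \<le> k"
  shows "card (plane_forms (Suc m) k :: ((nat \<Rightarrow> 'a::{field,finite}) \<Rightarrow> 'a) set) =
    card (plane_forms m k :: ((nat \<Rightarrow> 'a) \<Rightarrow> 'a) set) *
    card (line_polys (Suc m) (k - 1) :: ((nat \<Rightarrow> 'a) \<Rightarrow> 'a) set)"
proof -
  let ?join = "\<lambda>(G, A) x :: nat \<Rightarrow> 'a. G (\<lambda>i. x (Suc i)) + homogenize k A x"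
  have "bij_betw ?join (plane_forms m k \<times> line_polys (Suc m) (k - 1)) (plane_forms (Suc m) k)"
    unfolding bij_betw_def
  proof
    show "inj_on ?join (plane_forms m k \<times> line_polys (Suc m) (k - 1))"
    proof (rule inj_onI)
      fix p p' :: "((nat \<Rightarrow> 'a) \<Rightarrow> 'a) \<times> ((nat \<Rightarrow> 'a) \<Rightarrow> 'a)"
      assume pp: "p \<in> plane_forms m k \<times> line_polys (Suc m) (k - 1)"
        "p' \<in> plane_forms m k \<times> line_polys (Suc m) (k - 1)" "?join p = ?join p'"
      obtain G A G' A' where p: "p = (G, A)" "p' = (G', A')" by (metis surj_pair)
      with pp have mem: "A \<in> line_polys (Suc m) (k - 1)" "A' \<in> line_polys (Suc m) (k - 1)"
        by auto
      from pp(3) have eq: "G (\<lambda>i. x (Suc i)) + homogenize k A x = G' (\<lambda>i. x (Suc i)) + homogenize k A' x" for x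
        by (simp add: fun_eq_iff p)
      \<comment> \<open>At coordinate 0 equal to 0 the homogenized summand vanishes, which isolates
        \<open>G\<close>; at coordinate 0 equal to 1 it takes the values of \<open>A\<close>, which
        isolates \<open>A\<close>.\<close>
      have "G x = G' x" for x
        using eq[of "case_nat 0 x"] by (simp add: homogenize_def)
      then have G: "G = G'" by blast
      have "A y = A' y" for y
      proof (cases "y 0 = 0")
        case True
        then have "(\<lambda>i. if i = 0 then 0 else (y(0 := 1)) i / (y(0 := 1)) 0) = y" by auto
        with eq[of "y(0 := 1)"] G show ?thesis by (simp add: homogenize_def)
      next
        case False
        then have "y \<notin> vecs {1..Suc m}" by (auto simp: vecs_def intro!: exI[of _ 0])
        with mem show ?thesis by (simp add: line_polys_outside)
      qed
      with G p show "p = p'" by blast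
    qed
    show "?join ` (plane_forms m k \<times> line_polys (Suc m) (k - 1)) = plane_forms (Suc m) k"
    proof (intro equalityI subsetI)
      fix F :: "(nat \<Rightarrow> 'a) \<Rightarrow> 'a"
      assume "F \<in> plane_forms (Suc m) k"
      then obtain G A where "G \<in> plane_forms m k" "A \<in> line_polys (Suc m) (k - 1)"
        "F = (\<lambda>x. G (\<lambda>i. x (Suc i)) + homogenize k A x)"
        by (rule plane_forms_decompose[OF _ k])
      then show "F \<in> ?join ` (plane_forms m k \<times> line_polys (Suc m) (k - 1))"
        by (intro image_eqI[of _ _ "(G, A)"]) auto
    qed (auto intro!: plane_forms_add plane_forms_cone homogenize_plane_forms k)
  qed
  from bij_betw_same_card[OF this] show ?thesis by (simp add: card_cartesian_product)
qed

section \<open>Polynomial representability\<close>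

text \<open>As \<open>d\<close> is positive, each nonzero summand has a variable factor x_i.
  Replacing one such factor by x_i^q raises the degree by q - 1 and keeps all values.\<close>

lemma form_fun_cone:
  assumes "form_fun {0..n} d (H :: (nat \<Rightarrow> 'a::{field,finite}) \<Rightarrow> 'a)" "1 \<le> d"
  shows "form_fun {0..Suc n} (d + (CARD('a) - 1)) (\<lambda>x. H (\<lambda>i. x (Suc i)))"
  using assms
proof (induction rule: form_fun.induct)
  case (var_mult i d F)
  have "form_fun {0..Suc n} (1 * CARD('a) + d) (\<lambda>x. x (Suc i) ^ CARD('a) * F (\<lambda>i. x (Suc i)))"
    using var_mult(1,2)
    by (intro form_fun_mult form_fun_power form_fun_var form_fun_substitute[where g = "\<lambda>x i. x (Suc i)"]) auto
  moreover have "1 * CARD('a) + d = Suc d + (CARD('a) - 1)"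
    using card_field_ge_2[where 'a = 'a] by simp
  ultimately show ?case by (simp only: power_card)
qed (auto intro: form_fun.intros)

text \<open>An element of \<^term>\<open>line_polys m d\<close> has degree at most \<open>d\<close> in the first variable,
  and as a reduced polynomial at most \<open>q - 1\<close> in each of the others.\<close>

lemma homogenize_form_fun:
  assumes A: "A \<in> (line_polys (Suc n) (k - 1) :: ((nat \<Rightarrow> 'a::{field,finite}) \<Rightarrow> 'a) set)"
    and k: "1 \<le> k"
  shows "\<exists>H. form_fun {0..Suc n} (k + n * (CARD('a) - 1)) H \<and>
    (\<forall>x\<in>vecs {0..Suc n}. homogenize k A x = H x)"
proof -
  let ?q = "CARD('a)"
  have unit: "(unit_vec 1 :: nat \<Rightarrow> 'a) \<in> vecs {1..Suc n}" by (simp add: vecs_def unit_vec_def)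
  have sub: "b \<in> vecs {1..Suc n}" if "b \<in> vecs {2..Suc n}" for b :: "nat \<Rightarrow> 'a"
    using that by (auto simp: vecs_def)
  \<comment> \<open>The lines parallel to the first axis: \<open>b\<close> fixes the other affine
    coordinates, and \<open>g b\<close> is \<open>A\<close> as a polynomial in the first
    one.\<close>
  have "\<forall>b\<in>vecs {2..Suc n}. \<exists>g. degree g \<le> k - 1 \<and> (\<forall>t. A (\<lambda>i. b i + t * unit_vec 1 i) = poly g t)"
    by (intro ballI line_polys_line[OF A] sub unit)
  then obtain g where g: "\<forall>b\<in>vecs {2..Suc n}. degree (g b) \<le> k - 1 \<and>
      (\<forall>t. A (\<lambda>i. b i + t * unit_vec 1 i) = poly (g b) t)"
    by (rule bchoice[THEN exE])
  have deg: "degree (g b) < k" if "b \<in> vecs {2..Suc n}" for b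
  proof -
    have "degree (g b) \<le> k - 1" using g that by blast
    with k show ?thesis by linarith
  qed
  \<comment> \<open>Homogenized Lagrange interpolation over \<open>b\<close>: the first factor is
    the degree k homogenization of \<open>g b\<close>, and each of the n further factors, of degree
    q - 1, tests whether x_i / x_0 = b_i.\<close>
  define H where "H x = (\<Sum>b\<in>vecs {2..Suc n}.
      (\<Sum>d\<le>degree (g b). coeff (g b) d * (x 0 ^ (k - d) * x 1 ^ d)) *
      (\<Prod>i\<in>{2..Suc n}. x 0 ^ (?q - 1) - (x i - b i * x 0) ^ (?q - 1)))" for x :: "nat \<Rightarrow> 'a"
  have "form_fun {0..Suc n} (k + (\<Sum>i\<in>{2..Suc n}. 1 * (?q - 1))) H"
    unfolding H_def
    by (intro form_fun_sum form_fun_mult binary_form_homogenization deg form_fun_prod form_fun_diff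
        form_fun_power form_fun_var form_fun_cmult) auto
  then have "form_fun {0..Suc n} (k + n * (?q - 1)) H" by simp
  moreover have "homogenize k A x = H x" if x: "x \<in> vecs {0..Suc n}" for x
  proof (cases "x 0 = 0")
    case True
    then have "H x = 0"
      unfolding H_def by (intro sum.neutral ballI) (simp add: homogenization_eval deg)
    with True show ?thesis by (simp add: homogenize_def)
  next
    case False
    \<comment> \<open>The one \<open>b\<close> whose product does not vanish.\<close>
    define y where "y i = (if i \<in> {2..Suc n} then x i / x 0 else 0)" for i
    have y: "y \<in> vecs {2..Suc n}" by (simp add: y_def vecs_def)
    have "(\<Prod>i\<in>{2..Suc n}. x 0 ^ (?q - 1) - (x i - b i * x 0) ^ (?q - 1)) = (if b = y then 1 else 0)"
      if b: "b \<in> vecs {2..Suc n}" for b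
    proof -
      have "x i - b i * x 0 = 0 \<longleftrightarrow> b i = y i" if "i \<in> {2..Suc n}" for i
        using False that by (auto simp: y_def field_simps)
      moreover have "b = y \<longleftrightarrow> (\<forall>i\<in>{2..Suc n}. b i = y i)"
        using b y by (auto simp: vecs_def fun_eq_iff)
      ultimately have "(\<forall>i\<in>{2..Suc n}. x i - b i * x 0 = 0) \<longleftrightarrow> b = y" by blast
      with prod_one_minus_power_card[of "{2..Suc n}" "\<lambda>i. x i - b i * x 0"] show ?thesis
        by (simp only: finite_field_power_card_minus_1[OF False] finite_atLeastAtMost)
    qed
    then have "H x = (\<Sum>b\<in>vecs {2..Suc n}. if b = y then x 0 ^ k * poly (g b) (x 1 / x 0) else 0)"
      unfolding H_def using False by (intro sum.cong) (simp_all add: homogenization_eval deg)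
    also have "\<dots> = x 0 ^ k * poly (g y) (x 1 / x 0)"
      using y by (simp add: finite_vecs sum.delta)
    also have "poly (g y) (x 1 / x 0) = A (\<lambda>i. y i + x 1 / x 0 * unit_vec 1 i)"
      using g y by metis
    also have "(\<lambda>i. y i + x 1 / x 0 * unit_vec 1 i) = (\<lambda>i. if i = 0 then 0 else x i / x 0)"
    proof
      fix i
      consider "i = 0" | "i = 1" | "i \<in> {2..Suc n}" | "2 \<le> i" "i \<notin> {0..Suc n}"
        by (cases "i \<le> 1") (auto simp: le_Suc_eq One_nat_def)
      then show "y i + x 1 / x 0 * unit_vec 1 i = (if i = 0 then 0 else x i / x 0)"
        using x by cases (simp_all add: y_def unit_vec_def vecs_def)
    qed
    finally show ?thesis using False by (simp add: homogenize_def)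
  qed
  ultimately show ?thesis by blast
qed

text \<open>Induction along \<open>plane_forms_decompose\<close>: each further coordinate adds q - 1
  to the degree, both for the cone over \<open>G\<close> and for the homogenized \<open>A\<close>,
  so the two forms can be added. The resulting degree is the one in the definition of
  \<open>PLift\<close>.\<close>

lemma plane_forms_form_fun:
  assumes "F \<in> (plane_forms (Suc n) k :: ((nat \<Rightarrow> 'a::{field,finite}) \<Rightarrow> 'a) set)" "1 \<le> k"
  shows "\<exists>H. form_fun {0..Suc n} (k + n * (CARD('a) - 1)) H \<and> (\<forall>x\<in>vecs {0..Suc n}. F x = H x)"
  using assms(1)
proof (induction n arbitrary: F)
  case 0
  \<comment> \<open>The projective line is covered by a single plane, the one of the two unit
    vectors.\<close>
  define H where "H x = F (\<lambda>i. x 0 * unit_vec 0 i + x 1 * unit_vec 1 i)" for x :: "nat \<Rightarrow> 'a"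
  have "form_fun {0, 1} k H"
    unfolding H_def by (rule plane_forms_form[OF 0]) (simp_all add: vecs_def unit_vec_def)
  moreover have "{0..Suc 0} = {0, 1}" by auto
  moreover have "F x = H x" if "x \<in> vecs {0..Suc 0}" for x
  proof -
    have "(\<lambda>i. x 0 * unit_vec 0 i + x 1 * unit_vec 1 i) = x"
    proof
      fix i
      show "x 0 * unit_vec 0 i + x 1 * unit_vec 1 i = x i"
        using that by (cases "i = 0 \<or> i = 1") (auto simp: vecs_def unit_vec_def)
    qed
    then show ?thesis by (simp add: H_def)
  qed
  ultimately show ?case by auto
next
  case (Suc n)
  obtain G A where G: "G \<in> plane_forms (Suc n) k" and A: "A \<in> line_polys (Suc (Suc n)) (k - 1)"
    and F: "F = (\<lambda>x. G (\<lambda>i. x (Suc i)) + homogenize k A x)"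
    by (rule plane_forms_decompose[OF Suc(2) assms(2)])
  from Suc.IH[OF G] obtain HG where HG: "form_fun {0..Suc n} (k + n * (CARD('a) - 1)) HG"
    "\<forall>x\<in>vecs {0..Suc n}. G x = HG x" by blast
  from homogenize_form_fun[OF A assms(2)] obtain HA where
    HA: "form_fun {0..Suc (Suc n)} (k + Suc n * (CARD('a) - 1)) HA"
    "\<forall>x\<in>vecs {0..Suc (Suc n)}. homogenize k A x = HA x" by blast
  have "form_fun {0..Suc (Suc n)} (k + n * (CARD('a) - 1) + (CARD('a) - 1)) (\<lambda>x. HG (\<lambda>i. x (Suc i)))"
    using assms(2) by (intro form_fun_cone HG) simp
  then have "form_fun {0..Suc (Suc n)} (k + Suc n * (CARD('a) - 1)) (\<lambda>x. HG (\<lambda>i. x (Suc i)) + HA x)"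
    by (intro form_fun.add HA) (simp add: ac_simps)
  moreover have "F x = HG (\<lambda>i. x (Suc i)) + HA x" if "x \<in> vecs {0..Suc (Suc n)}" for x
  proof -
    have "(\<lambda>i. x (Suc i)) \<in> vecs {0..Suc n}" using that by (simp add: vecs_def)
    with HG(2) HA(2) that F show ?thesis by simp
  qed
  ultimately show ?case by blast
qed


section \<open>The affine code\<close>

lemma poly_mv_subst:
  fixes f :: "'a::field mvpoly"
  shows "poly (mv_subst (\<lambda>c. [:c:]) g f) t = mv_eval f (\<lambda>i. poly (g i) t)"
  by (simp add: mv_subst_def mv_eval_def poly_sum poly_prod)

lemma poly_comp_aff:
  "poly (comp_aff f L) t = mv_eval f (\<lambda>i. L (unit_vec 0) i + t * L (unit_vec 1) i)"
  by (simp add: comp_aff_def poly_mv_subst)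

text \<open>Lagrange interpolation: the product for \<open>b\<close> takes the value 1 at
  \<open>b\<close> and 0 at every other point of \<open>vecs I\<close>.\<close>

lemma function_is_polynomial:
  fixes F :: "(nat \<Rightarrow> 'a::{field,finite}) \<Rightarrow> 'a"
  assumes "finite I"
  shows "\<exists>f\<in>mv_polys I. \<forall>x\<in>vecs I. mv_eval f x = F x"
proof -
  define f where "f = (\<Sum>b\<in>vecs I. mv_const (F b) *
      (\<Prod>i\<in>I. mv_const 1 + mv_const (-1) * (mv_var i + mv_const (- b i)) ^ (CARD('a) - 1)))"
  have "f \<in> mv_polys I"
    unfolding f_def
    by (intro mv_polys_sum mv_polys_mult mv_polys_prod mv_polys_add mv_polys_power mv_polys_const mv_polys_var)
  moreover have "mv_eval f x = F x" if x: "x \<in> vecs I" for x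
  proof -
    have "mv_eval f x = (\<Sum>b\<in>vecs I. F b * (\<Prod>i\<in>I. 1 - (x i - b i) ^ (CARD('a) - 1)))"
      by (simp add: f_def)
    also have "\<dots> = (\<Sum>b\<in>vecs I. if b = x then F b else 0)"
    proof (intro sum.cong refl)
      fix b :: "nat \<Rightarrow> 'a" assume "b \<in> vecs I"
      with x have "(\<forall>i\<in>I. x i - b i = 0) \<longleftrightarrow> b = x"
        by (auto simp: vecs_def fun_eq_iff) metis
      with assms show "F b * (\<Prod>i\<in>I. 1 - (x i - b i) ^ (CARD('a) - 1)) = (if b = x then F b else 0)"
        by (simp add: prod_one_minus_power_card)
    qed
    also have "\<dots> = F x"
      using x assms by (simp add: finite_vecs sum.delta)
    finally show ?thesis .
  qed
  ultimately show ?thesis by blast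
qed

lemma unit_vec_in_vecs: "j \<in> I \<Longrightarrow> unit_vec j \<in> vecs I"
  by (auto simp: vecs_def unit_vec_def)

lemma linear_between_comb:
  assumes "u \<in> vecs J" "v \<in> vecs J"
  shows "linear_between {0, 1} J (\<lambda>x i. x 0 * u i + x 1 * v i)"
  using assms by (auto simp: linear_between_def vecs_def fun_scale_def fun_eq_iff algebra_simps)

text \<open>Completed by the first coordinate as \<open>L0\<close>, the map sends (1, 0) to (1, a)
  and (0, 1) to (0, b); these are independent because \<open>b\<close> is not 0.\<close>

lemma comb_in_Emb_aff:
  assumes "a \<in> vecs {1..m}" "b \<in> vecs {1..m}" "b \<noteq> 0"
  shows "(\<lambda>x i. x 0 * a i + x 1 * b i) \<in> Emb_aff m"
proof -
  let ?L = "\<lambda>(x :: nat \<Rightarrow> 'a) i. x 0 * a i + x 1 * b i"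
  have ab: "a 0 = 0" "b 0 = 0" "a \<in> vecs {0..m}" "b \<in> vecs {0..m}"
    using assms by (simp_all add: vecs_1_iff)
  have "(\<lambda>x. (?L x)(0 := x 0)) = (\<lambda>(x :: nat \<Rightarrow> 'a) i. x 0 * (a(0 := 1)) i + x 1 * b i)"
    using ab by (auto simp: fun_eq_iff)
  moreover have "a(0 := 1) \<in> vecs {0..m}" using ab by (simp add: vecs_def)
  then have "linear_between {0, 1} {0..m} (\<lambda>x i. x 0 * (a(0 := 1)) i + x 1 * b i)"
    using ab(4) by (rule linear_between_comb)
  ultimately have "linear_between {0, 1} {0..m} (\<lambda>x. (?L x)(0 := x 0))"
    by (simp only:)
  moreover have "inj_on (\<lambda>x. (?L x)(0 := x 0)) (vecs {0, 1})"
  proof (rule inj_onI)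
    fix x y :: "nat \<Rightarrow> 'a"
    assume xy: "x \<in> vecs {0, 1}" "y \<in> vecs {0, 1}" "(?L x)(0 := x 0) = (?L y)(0 := y 0)"
    have eq: "((?L x)(0 := x 0)) i = ((?L y)(0 := y 0)) i" for i using xy(3) by simp
    from eq[of 0] have "x 0 = y 0" by simp
    from assms(3) obtain i where i: "b i \<noteq> 0" by (auto simp: fun_eq_iff)
    with ab have "i \<noteq> 0" by metis
    with eq[of i] \<open>x 0 = y 0\<close> i have "x 1 = y 1" by simp
    show "x = y"
    proof
      fix j
      show "x j = y j"
        using xy(1,2) \<open>x 0 = y 0\<close> \<open>x 1 = y 1\<close> by (cases "j = 0 \<or> j = 1") (auto simp: vecs_def)
    qed
  qed
  ultimately have "(\<lambda>x. (?L x)(0 := x 0)) \<in> Emb_proj m" by (simp add: Emb_proj_def)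
  with assms show ?thesis
    by (auto simp: Emb_aff_def linear_between_comb intro!: exI[of _ "\<lambda>x. x 0"])
qed

text \<open>Every parametrized line with nonzero direction comes from an affine embedding, and a
  constant one imposes only a constant polynomial. Conversely an embedding parametrizes a line,
  possibly constant, and every function on a finite space is polynomial.\<close>

lemma Lift_eq_line_polys: "Lift m d = (line_polys m d :: ((nat \<Rightarrow> 'a::{field,finite}) \<Rightarrow> 'a) set)"
proof (intro equalityI subsetI)
  fix F :: "(nat \<Rightarrow> 'a) \<Rightarrow> 'a" assume "F \<in> Lift m d"
  then obtain f where F: "F = ev_aff m f"
    and f: "\<And>L. L \<in> Emb_aff m \<Longrightarrow> poly (comp_aff f L) \<in> RS d"
    by (auto simp: Lift_def)
  have "\<exists>g. degree g \<le> d \<and> (\<forall>t. F (\<lambda>i. a i + t * b i) = poly g t)"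
    if ab: "a \<in> vecs {1..m}" "b \<in> vecs {1..m}" for a b
  proof (cases "b = 0")
    case True
    then show ?thesis by (intro exI[of _ "[:F a:]"]) simp
  next
    case False
    let ?L = "\<lambda>(x :: nat \<Rightarrow> 'a) i. x 0 * a i + x 1 * b i"
    have "poly (comp_aff f ?L) \<in> RS d" by (intro f comb_in_Emb_aff ab False)
    then obtain g where g: "degree g \<le> d" "poly (comp_aff f ?L) = poly g" by (auto simp: RS_def)
    have "F (\<lambda>i. a i + t * b i) = poly g t" for t
    proof -
      have "(\<lambda>i. a i + t * b i) \<in> vecs {1..m}" using ab by (simp add: vecs_def)
      then have "F (\<lambda>i. a i + t * b i) = poly (comp_aff f ?L) t"
        by (simp add: F ev_aff_def poly_comp_aff unit_vec_def)
      with g(2) show ?thesis by simp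
    qed
    with g(1) show ?thesis by blast
  qed
  then show "F \<in> line_polys m d" by (simp add: line_polys_def F ev_aff_def)
next
  fix F :: "(nat \<Rightarrow> 'a) \<Rightarrow> 'a" assume F: "F \<in> line_polys m d"
  from function_is_polynomial[of "{1..m}" F] obtain f
    where f: "f \<in> mv_polys {1..m}" "\<forall>x\<in>vecs {1..m}. mv_eval f x = F x" by auto
  have "F = ev_aff m f"
    using f(2) by (auto simp: ev_aff_def line_polys_outside[OF F])
  moreover have "poly (comp_aff f L) \<in> RS d" if "L \<in> Emb_aff m" for L
  proof -
    from that have "\<forall>x\<in>vecs {0, 1}. L x \<in> vecs {1..m}"
      by (simp add: Emb_aff_def linear_between_def)
    then have L: "L (unit_vec 0) \<in> vecs {1..m}" "L (unit_vec 1) \<in> vecs {1..m}"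
      by (auto intro: unit_vec_in_vecs)
    from line_polys_line[OF F L] obtain g where g: "degree g \<le> d"
      "\<forall>t. F (\<lambda>i. L (unit_vec 0) i + t * L (unit_vec 1) i) = poly g t" by blast
    have "poly (comp_aff f L) t = poly g t" for t
    proof -
      have "(\<lambda>i. L (unit_vec 0) i + t * L (unit_vec 1) i) \<in> vecs {1..m}"
        using L by (simp add: vecs_def)
      with f(2) g(2) show ?thesis by (simp add: poly_comp_aff)
    qed
    then have "poly (comp_aff f L) = poly g" by blast
    with g(1) show ?thesis by (auto simp: RS_def)
  qed
  ultimately show "F \<in> Lift m d" using f(1) by (auto simp: Lift_def)
qed

lemma subspace_line_polys: "word.subspace (line_polys m d)"
proof (rule word.subspaceI)
  show "0 \<in> line_polys m d"
    by (auto simp: line_polys_def intro!: exI[of _ 0])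
next
  fix F G :: "(nat \<Rightarrow> 'a) \<Rightarrow> 'a" assume FG: "F \<in> line_polys m d" "G \<in> line_polys m d"
  have "\<exists>g. degree g \<le> d \<and> (\<forall>t. (F + G) (\<lambda>i. a i + t * b i) = poly g t)"
    if ab: "a \<in> vecs {1..m}" "b \<in> vecs {1..m}" for a b
  proof -
    from line_polys_line[OF FG(1) ab] obtain g
      where "degree g \<le> d \<and> (\<forall>t. F (\<lambda>i. a i + t * b i) = poly g t)" ..
    moreover from line_polys_line[OF FG(2) ab] obtain h
      where "degree h \<le> d \<and> (\<forall>t. G (\<lambda>i. a i + t * b i) = poly h t)" ..
    ultimately show ?thesis
      by (intro exI[of _ "g + h"]) (simp add: degree_add_le)
  qed
  with FG show "F + G \<in> line_polys m d" by (simp add: line_polys_def)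
next
  fix c and F :: "(nat \<Rightarrow> 'a) \<Rightarrow> 'a" assume F: "F \<in> line_polys m d"
  have "\<exists>g. degree g \<le> d \<and> (\<forall>t. fun_scale c F (\<lambda>i. a i + t * b i) = poly g t)"
    if ab: "a \<in> vecs {1..m}" "b \<in> vecs {1..m}" for a b
  proof -
    from line_polys_line[OF F ab] obtain g
      where "degree g \<le> d \<and> (\<forall>t. F (\<lambda>i. a i + t * b i) = poly g t)" ..
    then show ?thesis
      by (intro exI[of _ "smult c g"]) (auto simp: fun_scale_def intro: order_trans[OF degree_smult_le])
  qed
  with F show "fun_scale c F \<in> line_polys m d" by (simp add: line_polys_def fun_scale_def)
qed

lemma finite_line_polys: "finite (line_polys m d :: ((nat \<Rightarrow> 'a::{field,finite}) \<Rightarrow> 'a) set)"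
  by (rule finite_functions_supported_in[of "vecs {1..m}"])
    (auto intro: finite_vecs line_polys_outside)

section \<open>The projective code\<close>

text \<open>The class consists of the multiples c x with c nonzero, whose leading coordinate is c
  times that of \<open>x\<close>; exactly one c makes it 1.\<close>

lemma std_rep_proportional_class:
  assumes "x \<in> nonzero_vecs m"
  shows "std_rep (proportional m `` {x}) = fun_scale (inverse (x (LEAST i. x i \<noteq> 0))) x"
proof -
  define l where "l = x (LEAST i. x i \<noteq> 0)"
  from assms have "\<exists>i. x i \<noteq> 0" by (auto simp: nonzero_vecs_def fun_eq_iff)
  then have l: "l \<noteq> 0" unfolding l_def by (rule LeastI_ex)
  \<comment> \<open>Scaling by a nonzero constant does not move the leading index.\<close>
  have lead: "fun_scale c x (LEAST i. fun_scale c x i \<noteq> 0) = c * l" if "c \<noteq> 0" for c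
    using that by (simp add: fun_scale_def l_def)
  have mem: "y \<in> proportional m `` {x} \<longleftrightarrow> (\<exists>c. c \<noteq> 0 \<and> y = fun_scale c x)" for y
    using assms by (auto simp: proportional_def nonzero_vecs_def vecs_def fun_scale_def fun_eq_iff)
  have "std_rep (proportional m `` {x}) = fun_scale (inverse l) x"
    unfolding std_rep_def
  proof (rule the_equality)
    show "fun_scale (inverse l) x \<in> proportional m `` {x} \<and>
        fun_scale (inverse l) x (LEAST i. fun_scale (inverse l) x i \<noteq> 0) = 1"
      unfolding mem using l lead[of "inverse l"] by (intro conjI exI[of _ "inverse l"]) simp_all
  next
    fix y assume "y \<in> proportional m `` {x} \<and> y (LEAST i. y i \<noteq> 0) = 1"
    then obtain c where c: "c \<noteq> 0" "y = fun_scale c x" "y (LEAST i. y i \<noteq> 0) = 1"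
      unfolding mem by blast
    then have "c * l = 1" using lead by metis
    then have "c = inverse l" using l by (simp add: field_simps)
    with c show "y = fun_scale (inverse l) x" by simp
  qed
  then show ?thesis by (simp add: l_def)
qed

lemma std_rep_in_vecs:
  assumes "P \<in> proj_space m"
  shows "std_rep P \<in> vecs {0..m}"
proof -
  from assms obtain x where "x \<in> nonzero_vecs m" "P = proportional m `` {x}"
    by (auto simp: proj_space_def quotient_def)
  then show ?thesis
    by (simp add: std_rep_proportional_class) (simp add: nonzero_vecs_def vecs_def fun_scale_def)
qed

lemma exists_std_rep:
  fixes x :: "nat \<Rightarrow> 'a::field"
  assumes "x \<in> vecs {0..m}" "x \<noteq> 0"
  shows "\<exists>P\<in>proj_space m. \<exists>c. x = (\<lambda>i. c * std_rep P i)"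
proof -
  have x: "x \<in> nonzero_vecs m" using assms by (simp add: nonzero_vecs_def)
  define l where "l = x (LEAST i. x i \<noteq> 0)"
  from assms(2) have "\<exists>i. x i \<noteq> 0" by (auto simp: fun_eq_iff)
  then have "l \<noteq> 0" unfolding l_def by (rule LeastI_ex)
  then have "x = (\<lambda>i. l * std_rep (proportional m `` {x}) i)"
    by (simp add: std_rep_proportional_class[OF x] fun_scale_def l_def[symmetric]
        mult.assoc[symmetric])
  moreover have "proportional m `` {x} \<in> proj_space m"
    unfolding proj_space_def using x by (rule quotientI)
  ultimately show ?thesis by blast
qed

lemma mv_eval_comp_proj:
  "mv_eval (comp_proj f L) x = mv_eval f (\<lambda>i. x 0 * L (unit_vec 0) i + x 1 * L (unit_vec 1) i)"
  by (simp add: comp_proj_def mv_subst_def mv_eval_altdef[of f] mono_eval_def mult.commute)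

section \<open>Codewords as restrictions of plane forms to the standard representatives\<close>

definition restrict_to_reps :: "nat \<Rightarrow> ((nat \<Rightarrow> 'a::field) \<Rightarrow> 'a) \<Rightarrow> (nat \<Rightarrow> 'a) set \<Rightarrow> 'a" where
  "restrict_to_reps m F = (\<lambda>P. if P \<in> proj_space m then F (std_rep P) else 0)"

lemma ev_proj_eq_restrict_to_reps: "ev_proj m f = restrict_to_reps m (mv_eval f)"
  by (simp add: ev_proj_def restrict_to_reps_def)

lemma restrict_to_reps_cong:
  "(\<And>x. x \<in> vecs {0..m} \<Longrightarrow> F x = G x) \<Longrightarrow> restrict_to_reps m F = restrict_to_reps m G"
  by (auto simp: restrict_to_reps_def std_rep_in_vecs)

text \<open>By homogeneity the value at a nonzero vector follows from that at the standard
  representative of its point; at the zero vector it is 0 because k is positive.\<close>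

lemma inj_on_restrict_to_reps:
  assumes "1 \<le> k"
  shows "inj_on (restrict_to_reps m) (plane_forms m k)"
proof (intro inj_onI ext)
  fix F G :: "(nat \<Rightarrow> 'a) \<Rightarrow> 'a" and x :: "nat \<Rightarrow> 'a"
  assume F: "F \<in> plane_forms m k" and G: "G \<in> plane_forms m k"
    and eq: "restrict_to_reps m F = restrict_to_reps m G"
  consider "x \<notin> vecs {0..m}" | "x \<in> vecs {0..m}" "x = 0" | "x \<in> vecs {0..m}" "x \<noteq> 0" by blast
  then show "F x = G x"
  proof cases
    case 1
    with F G show ?thesis by (simp add: plane_forms_outside)
  next
    case 2
    have zero: "H x = 0" if "H \<in> plane_forms m k" for H
      using plane_forms_homogeneous[OF that 2(1), of 0] 2(2) zero_power[of k, where 'a = 'a] assms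
      by (simp add: zero_fun_def)
    from zero[OF F] zero[OF G] show ?thesis by simp
  next
    case 3
    then obtain P c where P: "P \<in> proj_space m" "x = (\<lambda>i. c * std_rep P i)"
      using exists_std_rep by blast
    from fun_cong[OF eq, of P] P(1) have "F (std_rep P) = G (std_rep P)"
      by (simp add: restrict_to_reps_def)
    with F G P show ?thesis
      by (simp add: plane_forms_homogeneous std_rep_in_vecs)
  qed
qed

text \<open>Separates the pairs to which the code condition applies from those on which homogeneity
  alone decides. Naming a common \<open>w\<close> treats both ways of being dependent alike and
  includes zero vectors.\<close>

lemma comb_in_Emb_proj_or_dependent:
  fixes u v :: "nat \<Rightarrow> 'a::field"
  assumes "u \<in> vecs {0..m}" "v \<in> vecs {0..m}"
  obtains "(\<lambda>x i. x 0 * u i + x 1 * v i) \<in> Emb_proj m"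
  | w \<alpha> \<beta> where "w \<in> vecs {0..m}" "u = (\<lambda>i. \<alpha> * w i)" "v = (\<lambda>i. \<beta> * w i)"
proof (cases "inj_on (\<lambda>(x :: nat \<Rightarrow> 'a) i. x 0 * u i + x 1 * v i) (vecs {0, 1})")
  case True
  with assms have "(\<lambda>x i. x 0 * u i + x 1 * v i) \<in> Emb_proj m"
    by (simp add: Emb_proj_def linear_between_comb)
  then show thesis by (rule that)
next
  case False
  then obtain x y :: "nat \<Rightarrow> 'a" where xy: "x \<in> vecs {0, 1}" "y \<in> vecs {0, 1}" "x \<noteq> y"
    and eq: "(\<lambda>i. x 0 * u i + x 1 * v i) = (\<lambda>i. y 0 * u i + y 1 * v i)"
    unfolding inj_on_def by blast
  \<comment> \<open>The difference of two distinct points with the same image is a nontrivial linear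
    relation between \<open>u\<close> and \<open>v\<close>.\<close>
  define s t where "s = x 0 - y 0" and "t = x 1 - y 1"
  have st: "s * u i + t * v i = 0" for i
    using fun_cong[OF eq, of i] by (simp add: s_def t_def algebra_simps)
  show thesis
  proof (cases "t = 0")
    case True
    have "s \<noteq> 0"
    proof
      assume "s = 0"
      have "x j = y j" for j
        using xy(1,2) \<open>s = 0\<close> True by (cases "j = 0 \<or> j = 1") (auto simp: vecs_def s_def t_def)
      with xy(3) show False by blast
    qed
    with st True have "u = (\<lambda>i. 0 * v i)" by auto
    with assms show thesis by (intro that(2)[of v 0 1]) auto
  next
    case False
    have "v i = (- s / t) * u i" for i
    proof -
      have "t * v i = - s * u i" using st[of i] by (simp add: eq_neg_iff_add_eq_0 add.commute)
      with False show ?thesis by (simp add: field_simps)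
    qed
    with assms show thesis by (intro that(2)[of u 1 "- s / t"]) auto
  qed
qed

text \<open>On an embedded plane the code condition gives a binary form agreeing with
  \<open>f\<close> at the standard representatives. Both sides scale by c^k, since the degree of
  \<open>f\<close> exceeds k by a multiple of q - 1, so they agree at all vectors.\<close>

lemma hom_poly_in_plane_forms:
  fixes f :: "'a::{field,finite} mvpoly"
  assumes f: "f \<in> hom_polys {0..m} (k + n * (CARD('a) - 1))" and k: "1 \<le> k"
    and PRS: "\<And>L. L \<in> Emb_proj m \<Longrightarrow> ev_proj 1 (comp_proj f L) \<in> PRS k"
  shows "(\<lambda>x. if x \<in> vecs {0..m} then mv_eval f x else 0) \<in> plane_forms m k"
proof -
  have "form_fun {0..m} (k + n * (CARD('a) - 1)) (mv_eval f)"
    using f by (auto simp: form_fun_iff_hom_polys)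
  from form_fun_homogeneous[OF this] have hom: "mv_eval f (\<lambda>i. c * x i) = c ^ k * mv_eval f x" for c x
    by (simp only: power_add_mult_card_minus_1[OF k])
  have "form_fun {0, 1} k (\<lambda>x. mv_eval f (\<lambda>i. x 0 * u i + x 1 * v i))"
    if uv: "u \<in> vecs {0..m}" "v \<in> vecs {0..m}" for u v
    using uv
  proof (cases rule: comb_in_Emb_proj_or_dependent)
    case 1
    let ?L = "\<lambda>(x :: nat \<Rightarrow> 'a) i. x 0 * u i + x 1 * v i"
    from PRS[OF 1] obtain g where g: "g \<in> hom_polys {0, 1} k"
      and eq: "ev_proj 1 (comp_proj f ?L) = ev_proj 1 g"
      by (auto simp: PRS_def)
    have form: "form_fun {0, 1} k (mv_eval g)"
      using g by (auto simp: form_fun_iff_hom_polys)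
    have "mv_eval f (?L x) = mv_eval g x" for x
    proof -
      \<comment> \<open>Only the first two coordinates of \<open>x\<close> matter; cutting off the
        others gives a vector that is a multiple of a standard representative or 0.\<close>
      define y where "y i = (if i \<le> 1 then x i else 0)" for i
      have y: "y \<in> vecs {0..1}" by (simp add: y_def vecs_def)
      have "mv_eval f (?L y) = mv_eval g y"
      proof (cases "y = 0")
        case True
        then show ?thesis
          using hom[of 0 "\<lambda>_. 0"] form_fun_homogeneous[OF form, of 0 "\<lambda>_. 0"] zero_power[of k, where 'a = 'a] k
          by (simp add: zero_fun_def)
      next
        case False
        with y obtain P c where P: "P \<in> proj_space 1" "y = (\<lambda>i. c * std_rep P i)"
          using exists_std_rep by blast
        have "mv_eval f (?L (std_rep P)) = mv_eval g (std_rep P)"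
          using fun_cong[OF eq, of P] P(1)
          by (simp add: ev_proj_def mv_eval_comp_proj) (simp add: unit_vec_def)
        moreover have "?L y = (\<lambda>i. c * ?L (std_rep P) i)"
          by (simp add: P(2) algebra_simps)
        ultimately show ?thesis
          by (simp only: hom) (simp only: P(2) form_fun_homogeneous[OF form])
      qed
      moreover have "mv_eval g y = mv_eval g x"
        by (rule form_fun_cong_args[OF form]) (auto simp: y_def)
      ultimately show ?thesis by (simp add: y_def)
    qed
    with form show ?thesis by simp
  next
    case (2 w \<alpha> \<beta>)
    \<comment> \<open>With u = \<alpha> w and v = \<beta> w, homogeneity turns \<open>f\<close> on
      the pair into \<open>f\<close> at \<open>w\<close> times the k-th power of a linear
      form.\<close>
    have "form_fun {0, 1} (1 * k) (\<lambda>x. (\<alpha> * x 0 + \<beta> * x 1) ^ k)"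
      by (intro form_fun_power form_fun.add form_fun_cmult form_fun_var) auto
    then have "form_fun {0, 1} k (\<lambda>x. mv_eval f w * (\<alpha> * x 0 + \<beta> * x 1) ^ k)"
      by (simp add: form_fun_cmult)
    moreover have "mv_eval f (\<lambda>i. x 0 * u i + x 1 * v i) = mv_eval f w * (\<alpha> * x 0 + \<beta> * x 1) ^ k"
      for x :: "nat \<Rightarrow> 'a"
      using hom[of "\<alpha> * x 0 + \<beta> * x 1" w] by (simp add: 2 algebra_simps)
    ultimately show ?thesis by simp
  qed
  moreover have "(\<lambda>i. x 0 * u i + x 1 * v i) \<in> vecs {0..m}"
    if "u \<in> vecs {0..m}" "v \<in> vecs {0..m}" for u v x :: "nat \<Rightarrow> 'a"
    using that by (simp add: vecs_def)
  ultimately show ?thesis by (simp add: plane_forms_def)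
qed

text \<open>From a codeword to a plane form by \<open>hom_poly_in_plane_forms\<close>; back by
  \<open>plane_forms_form_fun\<close>, which provides a form of the prescribed degree, and by
  applying the plane condition to the images of the two unit vectors under an embedding.\<close>

lemma PLift_eq_image:
  assumes "1 \<le> m" "1 \<le> k"
  shows "PLift m k = restrict_to_reps m ` (plane_forms m k :: ((nat \<Rightarrow> 'a::{field,finite}) \<Rightarrow> 'a) set)"
proof (intro equalityI subsetI)
  fix c :: "(nat \<Rightarrow> 'a) set \<Rightarrow> 'a" assume "c \<in> PLift m k"
  then obtain f :: "'a mvpoly" where f: "c = ev_proj m f"
    "f \<in> hom_polys {0..m} (k + (m - 1) * (CARD('a) - 1))"
    "\<And>L. L \<in> Emb_proj m \<Longrightarrow> ev_proj 1 (comp_proj f L) \<in> PRS k"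
    by (auto simp: PLift_def)
  show "c \<in> restrict_to_reps m ` plane_forms m k"
  proof (rule image_eqI[OF _ hom_poly_in_plane_forms[OF f(2) assms(2) f(3)]])
    show "c = restrict_to_reps m (\<lambda>x. if x \<in> vecs {0..m} then mv_eval f x else 0)"
      unfolding f(1) ev_proj_eq_restrict_to_reps by (rule restrict_to_reps_cong) simp
  qed
next
  fix c :: "(nat \<Rightarrow> 'a) set \<Rightarrow> 'a" assume "c \<in> restrict_to_reps m ` plane_forms m k"
  then obtain F where F: "F \<in> plane_forms m k" and c: "c = restrict_to_reps m F" by blast
  have m: "m = Suc (m - 1)" using assms(1) by simp
  obtain f :: "'a mvpoly" where f: "f \<in> hom_polys {0..m} (k + (m - 1) * (CARD('a) - 1))"
    and eq: "\<forall>x\<in>vecs {0..m}. F x = mv_eval f x"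
    using plane_forms_form_fun[of F "m - 1" k] F assms(2) m[symmetric]
    by (auto simp: form_fun_iff_hom_polys)
  have "c = ev_proj m f"
    unfolding c ev_proj_eq_restrict_to_reps by (rule restrict_to_reps_cong) (simp add: eq)
  moreover have "ev_proj 1 (comp_proj f L) \<in> PRS k" if "L \<in> Emb_proj m" for L
  proof -
    from that have "\<forall>x\<in>vecs {0, 1}. L x \<in> vecs {0..m}"
      by (simp add: Emb_proj_def linear_between_def)
    then have L: "L (unit_vec 0) \<in> vecs {0..m}" "L (unit_vec 1) \<in> vecs {0..m}"
      by (auto intro: unit_vec_in_vecs)
    obtain g where g: "g \<in> hom_polys {0, 1} k"
      "(\<lambda>x. F (\<lambda>i. x 0 * L (unit_vec 0) i + x 1 * L (unit_vec 1) i)) = mv_eval g"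
      using plane_forms_form[OF F L] by (auto simp: form_fun_iff_hom_polys)
    have "mv_eval (comp_proj f L) x = mv_eval g x" for x
    proof -
      have "(\<lambda>i. x 0 * L (unit_vec 0) i + x 1 * L (unit_vec 1) i) \<in> vecs {0..m}"
        using L by (simp add: vecs_def)
      with eq fun_cong[OF g(2), of x] show ?thesis by (simp add: mv_eval_comp_proj)
    qed
    then have "ev_proj 1 (comp_proj f L) = ev_proj 1 g" by (simp add: ev_proj_def cong: if_cong)
    with g(1) show ?thesis by (simp add: PRS_def)
  qed
  ultimately show "c \<in> PLift m k" using f by (auto simp: PLift_def)
qed

lemma subspace_restrict_to_reps: "word.subspace (restrict_to_reps m ` plane_forms m k)"
proof (rule word.subspaceI)
  have "(\<lambda>_. 0) \<in> plane_forms m k" by (simp add: plane_forms_def form_fun.zero)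
  then show "0 \<in> restrict_to_reps m ` plane_forms m k"
    by (rule rev_image_eqI) (auto simp: restrict_to_reps_def)
next
  fix c d :: "(nat \<Rightarrow> 'a) set \<Rightarrow> 'a"
  assume "c \<in> restrict_to_reps m ` plane_forms m k" "d \<in> restrict_to_reps m ` plane_forms m k"
  then obtain F G where "F \<in> plane_forms m k" "c = restrict_to_reps m F"
    "G \<in> plane_forms m k" "d = restrict_to_reps m G" by blast
  then show "c + d \<in> restrict_to_reps m ` plane_forms m k"
    by (intro image_eqI[OF _ plane_forms_add[of F m k G]]) (auto simp: restrict_to_reps_def)
next
  fix a and c :: "(nat \<Rightarrow> 'a) set \<Rightarrow> 'a"
  assume "c \<in> restrict_to_reps m ` plane_forms m k"
  then obtain F where "F \<in> plane_forms m k" "c = restrict_to_reps m F" by blast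
  then show "fun_scale a c \<in> restrict_to_reps m ` plane_forms m k"
    by (intro image_eqI[OF _ plane_forms_cmult[of F m k a]]) (auto simp: restrict_to_reps_def fun_scale_def)
qed

section \<open>Counting elements and comparing dimensions\<close>

lemma card_plane_forms:
  assumes "1 \<le> k"
  shows "card (plane_forms m k :: ((nat \<Rightarrow> 'a::{field,finite}) \<Rightarrow> 'a) set) =
    CARD('a) * (\<Prod>j = 1..m. card (line_polys j (k - 1) :: ((nat \<Rightarrow> 'a) \<Rightarrow> 'a) set))"
  by (induction m) (simp_all add: card_plane_forms_0 card_plane_forms_Suc[OF assms] algebra_simps)

theorem corollary28:
  fixes m k :: nat
  assumes "1 \<le> m" and "1 \<le> k" and "k \<le> CARD('a::{field,finite}) - 1"
  shows "word.dim (PLift m k :: ((nat \<Rightarrow> 'a) set \<Rightarrow> 'a) set) =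
    (\<Sum>j = 1..m. word.dim (Lift j (k - 1) :: ((nat \<Rightarrow> 'a) \<Rightarrow> 'a) set)) + 1"
proof -
  let ?P = "PLift m k :: ((nat \<Rightarrow> 'a) set \<Rightarrow> 'a) set"
  let ?L = "\<lambda>j. Lift j (k - 1) :: ((nat \<Rightarrow> 'a) \<Rightarrow> 'a) set"
  have "CARD('a) ^ word.dim ?P = card ?P"
    by (simp add: PLift_eq_image[OF assms(1,2)] card_subspace subspace_restrict_to_reps finite_plane_forms)
  also have "\<dots> = card (plane_forms m k :: ((nat \<Rightarrow> 'a) \<Rightarrow> 'a) set)"
    by (simp add: PLift_eq_image[OF assms(1,2)] card_image inj_on_restrict_to_reps[OF assms(2)])
  also have "\<dots> = CARD('a) * (\<Prod>j = 1..m. card (?L j))"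
    by (simp add: card_plane_forms[OF assms(2)] Lift_eq_line_polys)
  also have "\<dots> = CARD('a) * (\<Prod>j = 1..m. CARD('a) ^ word.dim (?L j))"
    by (simp add: Lift_eq_line_polys card_subspace subspace_line_polys finite_line_polys)
  also have "\<dots> = CARD('a) ^ ((\<Sum>j = 1..m. word.dim (?L j)) + 1)"
    by (simp add: power_add power_sum)
  \<comment> \<open>Since q is at least 2, equal powers of q have equal exponents.\<close>
  finally show ?thesis
    by (rule power_inject_exp[THEN iffD1, rotated]) (use card_field_ge_2[where 'a = 'a] in simp)
qed

end
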